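(* Let $F$ be a field of characteristic not $2$, let $a\in F^*$ be a non-square, and let $L=F(\sqrt{a})$. Then the Galois closure $\overline{L^{(3)}}$ of $L^{(3)}$ over $F$ is contained in $F^{(5)}$.
   Context: All fields are taken inside a fixed quadratic closure $F_q$ of $F$ (the compositum of all finite Galois extensions of $F$ of $2$-power degree, equivalently the smallest quadratically closed extension of $F$). For a field $K$ of characteristic not $2$ (inside $F_q$), define $K^{(1)}=K$ and, for $n\ge 1$, $K^{(n+1)}$ is the compositum of all quadratic extensions of $K^{(n)}$ which are Galois over $K$. For an extension $M/F$ inside $F_q$, $\overline{M}$ denotes the Galois closure of $M$ over $F$. *)

theory Defs
  imports "HOL-Computational_Algebra.Polynomial"
begin

text \<open>All fields are subsets of an ambient algebraically closed field (the type 'a).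
  The quadratic closure of F is formed inside it.\<close>

definition subfield :: "'a::field set \<Rightarrow> bool" where
  "subfield K \<longleftrightarrow> 0 \<in> K \<and> 1 \<in> K \<and> (\<forall>x\<in>K. \<forall>y\<in>K. x + y \<in> K \<and> x * y \<in> K)
      \<and> (\<forall>x\<in>K. - x \<in> K \<and> inverse x \<in> K)"

definition field_gen :: "'a::field set \<Rightarrow> 'a set" where
  "field_gen S = \<Inter>{K. subfield K \<and> S \<subseteq> K}"

definition adjoin :: "'a::field set \<Rightarrow> 'a set \<Rightarrow> 'a set" where
  "adjoin K S = field_gen (K \<union> S)"

definition kspan :: "'a::field set \<Rightarrow> 'a set \<Rightarrow> 'a set" where
  "kspan K S = {\<Sum>s\<in>T. c s * s | T c. finite T \<and> T \<subseteq> S \<and> (\<forall>s\<in>T. c s \<in> K)}"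

definition finite_ext :: "'a::field set \<Rightarrow> 'a set \<Rightarrow> bool" where
  "finite_ext K E \<longleftrightarrow> (\<exists>S. finite S \<and> S \<subseteq> E \<and> E \<subseteq> kspan K S)"

definition ext_degree :: "'a::field set \<Rightarrow> 'a set \<Rightarrow> nat" where
  "ext_degree K E = (LEAST n. \<exists>S. finite S \<and> card S = n \<and> S \<subseteq> E \<and> E \<subseteq> kspan K S)"

definition poly_over :: "'a::field set \<Rightarrow> 'a poly \<Rightarrow> bool" where
  "poly_over K p \<longleftrightarrow> (\<forall>i. coeff p i \<in> K)"

definition algebraic_ext :: "'a::field set \<Rightarrow> 'a set \<Rightarrow> bool" where
  "algebraic_ext K E \<longleftrightarrow> (\<forall>x\<in>E. \<exists>p. p \<noteq> 0 \<and> poly_over K p \<and> poly p x = 0)"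

definition normal_ext :: "'a::field set \<Rightarrow> 'a set \<Rightarrow> bool" where
  "normal_ext K E \<longleftrightarrow> (\<forall>x\<in>E. \<exists>p. p \<noteq> 0 \<and> poly_over K p \<and> poly p x = 0
      \<and> {y. poly p y = 0} \<subseteq> E)"

definition separable_ext :: "'a::field set \<Rightarrow> 'a set \<Rightarrow> bool" where
  "separable_ext K E \<longleftrightarrow> (\<forall>x\<in>E. \<exists>p. p \<noteq> 0 \<and> poly_over K p \<and> poly p x = 0 \<and> rsquarefree p)"

definition galois_ext :: "'a::field set \<Rightarrow> 'a set \<Rightarrow> bool" where
  "galois_ext K E \<longleftrightarrow> subfield K \<and> subfield E \<and> K \<subseteq> E \<and> algebraic_ext K E
      \<and> normal_ext K E \<and> separable_ext K E"

definition quad_closure :: "'a::field set \<Rightarrow> 'a set" where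
  "quad_closure F = field_gen (\<Union>{E. galois_ext F E \<and> finite_ext F E \<and> (\<exists>k. ext_degree F E = 2 ^ k)})"

definition quad_ext :: "'a::field set \<Rightarrow> 'a set \<Rightarrow> bool" where
  "quad_ext M E \<longleftrightarrow> subfield M \<and> subfield E \<and> M \<subseteq> E \<and> finite_ext M E \<and> ext_degree M E = 2"

definition qstep :: "'a::field set \<Rightarrow> 'a set \<Rightarrow> 'a set \<Rightarrow> 'a set" where
  "qstep F K M = field_gen (M \<union> \<Union>{E. E \<subseteq> quad_closure F \<and> quad_ext M E \<and> galois_ext K E})"

fun kseq :: "'a::field set \<Rightarrow> 'a set \<Rightarrow> nat \<Rightarrow> 'a set" where
  "kseq F K 0 = K"
| "kseq F K (Suc n) = qstep F K (kseq F K n)"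

text \<open>K^(n) (n \<ge> 1), with K^(1) = K, formed inside the quadratic closure of F.\<close>
definition Kpow :: "'a::field set \<Rightarrow> 'a set \<Rightarrow> nat \<Rightarrow> 'a set" where
  "Kpow F K n = kseq F K (n - 1)"

definition galois_closure :: "'a::field set \<Rightarrow> 'a set \<Rightarrow> 'a set" where
  "galois_closure F M = \<Inter>{E. E \<subseteq> quad_closure F \<and> galois_ext F E \<and> M \<subseteq> E}"

end

theory Submission
  imports Defs
begin

text \<open>
  Let \<open>Q\<close> be the smallest subfield containing \<open>F\<close> and closed under square roots, and let
  \<open>G\<close> be its automorphism group over \<open>F\<close>. Partial homomorphisms extend along square roots,
  so by Zorn's lemma \<open>G\<close> has fixed field \<open>F\<close>; its orbits on \<open>Q\<close> are finite. Hence the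
  \<open>G\<close>-stable fields between \<open>F\<close> and \<open>Q\<close> are Galois over \<open>F\<close>, and a square root of
  \<open>y \<in> F\<^sup>(\<^sup>n\<^sup>)\<close> lies in \<open>F\<^sup>(\<^sup>n\<^sup>+\<^sup>1\<^sup>)\<close> as soon as \<open>G\<close> fixes the class of \<open>y\<close> modulo squares.

  Let \<open>\<sigma> \<in> G\<close> move \<open>\<surd>a\<close>. If the class of \<open>y\<close> is fixed by the automorphisms over \<open>L\<close>, then
  the class of \<open>y \<cdot> \<sigma> y\<close> is fixed by \<open>G\<close>, and once \<open>y \<cdot> \<sigma> y\<close> is a square, the class
  of \<open>y\<close> is fixed by \<open>G\<close> too. Thus each step of the filtration over \<open>L\<close> costs two steps over \<open>F\<close>:
  \<open>L \<subseteq> F\<^sup>(\<^sup>2\<^sup>)\<close>, \<open>L\<^sup>(\<^sup>2\<^sup>) \<subseteq> F\<^sup>(\<^sup>3\<^sup>)\<close> (for \<open>y \<in> L\<close> the norm already lies in \<open>F\<close>), and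
  \<open>L\<^sup>(\<^sup>3\<^sup>) \<subseteq> F\<^sup>(\<^sup>5\<^sup>)\<close>. Since \<open>F\<^sup>(\<^sup>5\<^sup>)\<close> is itself Galois over \<open>F\<close>, it contains the Galois closure.
\<close>

section \<open>Subfields and quadratic adjunction\<close>

lemma subfieldD:
  assumes "subfield K"
  shows "0 \<in> K" "1 \<in> K" "x \<in> K \<Longrightarrow> y \<in> K \<Longrightarrow> x + y \<in> K"
    "x \<in> K \<Longrightarrow> y \<in> K \<Longrightarrow> x * y \<in> K" "x \<in> K \<Longrightarrow> - x \<in> K" "x \<in> K \<Longrightarrow> inverse x \<in> K"
    "x \<in> K \<Longrightarrow> y \<in> K \<Longrightarrow> x - y \<in> K" "x \<in> K \<Longrightarrow> y \<in> K \<Longrightarrow> x / y \<in> K"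
proof -
  show m: "0 \<in> K" "1 \<in> K" "\<And>x y. x \<in> K \<Longrightarrow> y \<in> K \<Longrightarrow> x + y \<in> K"
    "\<And>x y. x \<in> K \<Longrightarrow> y \<in> K \<Longrightarrow> x * y \<in> K" "\<And>x. x \<in> K \<Longrightarrow> - x \<in> K"
    "\<And>x. x \<in> K \<Longrightarrow> inverse x \<in> K"
    using assms by (auto simp: subfield_def)
  show "x - y \<in> K" if "x \<in> K" "y \<in> K"
    using m(3)[OF that(1) m(5)[OF that(2)]] by simp
  show "x / y \<in> K" if "x \<in> K" "y \<in> K"
    using m(4)[OF that(1) m(6)[OF that(2)]] by (simp add: divide_inverse)
qed

lemma subfieldI:
  assumes "1 \<in> K" "\<And>x y. x \<in> K \<Longrightarrow> y \<in> K \<Longrightarrow> x + y \<in> K"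
    "\<And>x y. x \<in> K \<Longrightarrow> y \<in> K \<Longrightarrow> x * y \<in> K" "\<And>x. x \<in> K \<Longrightarrow> - x \<in> K"
    "\<And>x. x \<in> K \<Longrightarrow> inverse x \<in> K"
  shows "subfield K"
proof -
  have "0 \<in> K" using assms(2)[OF assms(1) assms(4)[OF assms(1)]] by simp
  then show ?thesis using assms by (auto simp: subfield_def)
qed

lemma subfield_sum:
  assumes "subfield K" "\<And>i. i \<in> I \<Longrightarrow> f i \<in> K"
  shows "sum f I \<in> K"
  using assms(2) by (induction I rule: infinite_finite_induct) (auto simp: subfieldD[OF assms(1)])

lemma subfield_Inter: "(\<And>K. K \<in> \<K> \<Longrightarrow> subfield K) \<Longrightarrow> subfield (\<Inter>\<K>)"
  unfolding subfield_def by blast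

lemma subfield_field_gen [simp]: "subfield (field_gen S)"
  unfolding field_gen_def by (rule subfield_Inter) auto

lemma field_gen_superset: "S \<subseteq> field_gen S"
  unfolding field_gen_def by blast

lemma field_gen_least: "subfield K \<Longrightarrow> S \<subseteq> K \<Longrightarrow> field_gen S \<subseteq> K"
  unfolding field_gen_def by blast

lemma field_gen_mono: "S \<subseteq> T \<Longrightarrow> field_gen S \<subseteq> field_gen T"
  unfolding field_gen_def by blast

lemma field_gen_subfield: "subfield K \<Longrightarrow> field_gen K = K"
  using field_gen_least[of K K] field_gen_superset[of K] by blast

lemma subfield_adjoin [simp]: "subfield (adjoin K S)"
  by (simp add: adjoin_def)

lemma adjoin_superset: "K \<subseteq> adjoin K S"
  using field_gen_superset[of "K \<union> S"] by (auto simp: adjoin_def)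

lemma adjoin_generator [simp]: "z \<in> adjoin K {z}"
  using field_gen_superset[of "K \<union> {z}"] by (auto simp: adjoin_def)

lemma adjoin_least: "subfield E \<Longrightarrow> K \<subseteq> E \<Longrightarrow> S \<subseteq> E \<Longrightarrow> adjoin K S \<subseteq> E"
  unfolding adjoin_def by (rule field_gen_least) auto

lemma adjoin_trivial: "subfield K \<Longrightarrow> z \<in> K \<Longrightarrow> adjoin K {z} = K"
  using adjoin_least[of K K "{z}"] adjoin_superset[of K "{z}"] by blast

text \<open>The expression factors as \<open>(u - v * z) * (u + v * z)\<close>, the norm from
  \<open>K(z)\<close>; a vanishing factor would make \<open>z\<close> equal to \<open>u / v\<close>
  or its negative.\<close>

lemma quadratic_norm_nonzero:
  assumes "subfield K" "z \<notin> K" "u \<in> K" "v \<in> K" "u \<noteq> 0 \<or> v \<noteq> 0"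
  shows "u * u - v * v * (z * z) \<noteq> 0"
proof
  assume "u * u - v * v * (z * z) = 0"
  then have *: "(u - v * z) * (u + v * z) = 0" by (simp add: algebra_simps)
  have "v \<noteq> 0"
    using * assms(5) by auto
  then have "z = u / v \<or> z = - (u / v)"
    using * unfolding mult_eq_0_iff by (auto simp: eq_neg_iff_add_eq_0 field_simps)
  moreover have "u / v \<in> K" "- (u / v) \<in> K"
    using subfieldD(5,8)[OF assms(1)] assms(3,4) by auto
  ultimately show False using assms(2) by auto
qed

text \<open>Rationalising the denominator. As a bare field identity it applies on both sides of a
  partial homomorphism as well as inside \<open>K(z)\<close>.\<close>

lemma inverse_quadratic:
  fixes z :: "'a::field"
  assumes "n = u * u - v * v * (z * z)" "n \<noteq> 0"
  shows "inverse (u + v * z) = u * inverse n + - (v * inverse n) * z"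
proof (rule inverse_unique)
  have "(u + v * z) * (u * inverse n + - (v * inverse n) * z) = n * inverse n"
    unfolding assms(1) by (simp add: algebra_simps)
  then show "(u + v * z) * (u * inverse n + - (v * inverse n) * z) = 1" using assms(2) by simp
qed

text \<open>Closure of the right-hand side under inverses is the real point and comes from the
  nonvanishing norm. The case \<open>z \<in> K\<close> is included, so that towers may contain
  trivial steps.\<close>

lemma adjoin_square_root:
  assumes K: "subfield K" and z: "z * z \<in> K"
  shows "adjoin K {z} = {u + v * z | u v. u \<in> K \<and> v \<in> K}" (is "_ = ?E")
proof (cases "z \<in> K")
  case True
  have "?E \<subseteq> K" using True subfieldD[OF K] by blast
  moreover have "x \<in> ?E" if "x \<in> K" for x
    using that subfieldD[OF K] by (intro CollectI exI[of _ x] exI[of _ 0]) auto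
  ultimately show ?thesis using adjoin_trivial[OF K True] by blast
next
  case False
  note f = subfieldD[OF K]
  have "subfield ?E"
  proof (rule subfieldI)
    show "1 \<in> ?E" using f by (intro CollectI exI[of _ 1] exI[of _ 0]) auto
  next
    fix x y assume "x \<in> ?E" "y \<in> ?E"
    then obtain u v u' v' where x: "x = u + v * z" "u \<in> K" "v \<in> K"
      and y: "y = u' + v' * z" "u' \<in> K" "v' \<in> K" by blast
    have "x + y = (u + u') + (v + v') * z" using x y by (simp add: algebra_simps)
    moreover have "u + u' \<in> K" "v + v' \<in> K" using x y f by auto
    ultimately show "x + y \<in> ?E" by blast
    have "x * y = (u * u' + v * v' * (z * z)) + (u * v' + v * u') * z"
      using x y by (simp add: algebra_simps)
    moreover have "u * u' + v * v' * (z * z) \<in> K" "u * v' + v * u' \<in> K"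
      using x y z f by auto
    ultimately show "x * y \<in> ?E" by blast
  next
    fix x assume "x \<in> ?E"
    then obtain u v where x: "x = u + v * z" "u \<in> K" "v \<in> K" by blast
    have "- x = - u + (- v) * z" "- u \<in> K" "- v \<in> K" using x f by auto
    then show "- x \<in> ?E" by blast
    show "inverse x \<in> ?E"
    proof (cases "u = 0 \<and> v = 0")
      case True
      then have "inverse x = 0 + 0 * z" using x by simp
      then show ?thesis using f(1) by blast
    next
      case uv: False
      define n where "n = u * u - v * v * (z * z)"
      have n: "n \<noteq> 0" "n \<in> K"
        using quadratic_norm_nonzero[OF K False x(2,3)] uv f x z by (auto simp: n_def)
      have "inverse x = u * inverse n + - (v * inverse n) * z"
        unfolding x(1) by (rule inverse_quadratic[OF n_def n(1)])
      moreover have "u * inverse n \<in> K" "- (v * inverse n) \<in> K"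
        using f(4)[OF _ f(6)[OF n(2)]] f(5) x by auto
      ultimately show ?thesis by blast
    qed
  qed
  moreover have "K \<subseteq> ?E"
  proof
    fix x assume "x \<in> K"
    then show "x \<in> ?E" using f by (intro CollectI exI[of _ x] exI[of _ 0]) auto
  qed
  moreover have "{z} \<subseteq> ?E"
  proof -
    have "z = 0 + 1 * z" by simp
    then show ?thesis using f(1,2) by blast
  qed
  ultimately have "adjoin K {z} \<subseteq> ?E" by (rule adjoin_least)
  moreover have "?E \<subseteq> adjoin K {z}"
  proof
    fix x assume "x \<in> ?E"
    then obtain u v where x: "x = u + v * z" "u \<in> K" "v \<in> K" by blast
    then have "u \<in> adjoin K {z}" "v \<in> adjoin K {z}" "z \<in> adjoin K {z}"
      using adjoin_superset[of K "{z}"] by auto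
    then show "x \<in> adjoin K {z}"
      using x(1) subfieldD(3,4)[OF subfield_adjoin] by blast
  qed
  ultimately show ?thesis by blast
qed

section \<open>Linear algebra over a subfield\<close>

text \<open>Gaussian elimination by induction on the set \<open>J\<close> of equations: equation
  \<open>j\<close> is solved for the unknown at a pivot \<open>p\<close>, which leaves one equation
  and one unknown fewer.\<close>

lemma homogeneous_system_solution:
  fixes a :: "'i \<Rightarrow> 'j \<Rightarrow> 'a::field"
  assumes K: "subfield K" and "finite J" "finite I" "card J < card I"
    and "\<And>i j. i \<in> I \<Longrightarrow> j \<in> J \<Longrightarrow> a i j \<in> K"
  shows "\<exists>c. (\<forall>i\<in>I. c i \<in> K) \<and> (\<exists>i\<in>I. c i \<noteq> 0) \<and> (\<forall>j\<in>J. (\<Sum>i\<in>I. c i * a i j) = 0)"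
  using assms(2-)
proof (induction J arbitrary: I a rule: finite_induct)
  case empty
  then have "I \<noteq> {}" by auto
  then show ?case using subfieldD(2)[OF K] by (intro exI[of _ "\<lambda>_. 1"]) auto
next
  case (insert j J)
  note f = subfieldD[OF K]
  show ?case
  proof (cases "\<forall>i\<in>I. a i j = 0")
    case True
    have "\<exists>c. (\<forall>i\<in>I. c i \<in> K) \<and> (\<exists>i\<in>I. c i \<noteq> 0) \<and> (\<forall>j\<in>J. (\<Sum>i\<in>I. c i * a i j) = 0)"
      using insert.prems insert.hyps by (intro insert.IH) auto
    moreover have "(\<Sum>i\<in>I. c i * a i j) = 0" for c
      using True by (intro sum.neutral) simp
    ultimately show ?thesis by (metis insertE)
  next
    case False
    then obtain p where p: "p \<in> I" "a p j \<noteq> 0" by blast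
    define I' where "I' = I - {p}"
    \<comment> \<open>Subtracting a multiple of the pivot's coefficients makes the coefficient of
      every remaining unknown in equation \<open>j\<close> vanish.\<close>
    define a' where "a' i k = a i k - a i j / a p j * a p k" for i k
    have I: "I = insert p I'" "p \<notin> I'" "finite I'" using p insert.prems by (auto simp: I'_def)
    have "\<exists>c. (\<forall>i\<in>I'. c i \<in> K) \<and> (\<exists>i\<in>I'. c i \<noteq> 0) \<and> (\<forall>j\<in>J. (\<Sum>i\<in>I'. c i * a' i j) = 0)"
    proof (rule insert.IH)
      show "finite I'" "card J < card I'" using I insert.prems insert.hyps by auto
      show "a' i k \<in> K" if "i \<in> I'" "k \<in> J" for i k
        unfolding a'_def using that insert.prems(3) p f I by auto
    qed
    then obtain c where c: "\<forall>i\<in>I'. c i \<in> K" "\<exists>i\<in>I'. c i \<noteq> 0"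
      and c0: "\<forall>k\<in>J. (\<Sum>i\<in>I'. c i * a' i k) = 0" by blast
    define s where "s = (\<Sum>i\<in>I'. c i * a i j) / a p j"
    have s: "s \<in> K" unfolding s_def
      using c p insert.prems(3) I f by (intro f(8) subfield_sum[OF K]) auto
    \<comment> \<open>Equation \<open>j\<close> forces the value \<open>- s\<close> at the
      pivot.\<close>
    define d where "d = c(p := - s)"
    have d: "(\<Sum>i\<in>I. d i * a i k) = (\<Sum>i\<in>I'. c i * a i k) - s * a p k" for k
    proof -
      have "(\<Sum>i\<in>I'. d i * a i k) = (\<Sum>i\<in>I'. c i * a i k)"
        by (rule sum.cong) (use I in \<open>auto simp: d_def\<close>)
      then show ?thesis using I by (simp add: d_def)
    qed
    have "(\<Sum>i\<in>I. d i * a i k) = 0" if "k \<in> insert j J" for k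
    proof (cases "k = j")
      case True
      then show ?thesis using p by (simp add: d s_def)
    next
      case False
      have "(\<Sum>i\<in>I'. c i * a' i k) = (\<Sum>i\<in>I'. c i * a i k - c i * a i j * (a p k / a p j))"
        by (rule sum.cong) (simp_all add: a'_def algebra_simps)
      also have "\<dots> = (\<Sum>i\<in>I'. c i * a i k) - (\<Sum>i\<in>I'. c i * a i j) * (a p k / a p j)"
        by (simp add: sum_subtractf sum_distrib_right sum_divide_distrib)
      finally show ?thesis using that False c0 by (simp add: d s_def)
    qed
    moreover have "\<forall>i\<in>I. d i \<in> K" using c s f I by (auto simp: d_def)
    moreover have "\<exists>i\<in>I. d i \<noteq> 0" using c I by (auto simp: d_def)
    ultimately show ?thesis by blast
  qed
qed

lemma kspan_finite:
  assumes K: "subfield K" and S: "finite S"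
  shows "kspan K S = {\<Sum>s\<in>S. c s * s | c. \<forall>s\<in>S. c s \<in> K}"
proof (intro equalityI subsetI)
  fix x assume "x \<in> kspan K S"
  then obtain T c where T: "x = (\<Sum>s\<in>T. c s * s)" "T \<subseteq> S" "\<forall>s\<in>T. c s \<in> K"
    by (auto simp: kspan_def)
  define d where "d s = (if s \<in> T then c s else 0)" for s
  have "x = (\<Sum>s\<in>S. d s * s)"
    unfolding T(1) by (rule sum.mono_neutral_cong_left) (use T S in \<open>auto simp: d_def\<close>)
  moreover have "\<forall>s\<in>S. d s \<in> K" using T subfieldD(1)[OF K] by (auto simp: d_def)
  ultimately show "x \<in> {\<Sum>s\<in>S. c s * s | c. \<forall>s\<in>S. c s \<in> K}" by blast
qed (use S in \<open>auto simp: kspan_def\<close>)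

text \<open>Meant for finite \<open>B\<close>: over an infinite set the sum defaults to 0.\<close>

definition independent_over :: "'a::field set \<Rightarrow> 'a set \<Rightarrow> bool" where
  "independent_over K B \<longleftrightarrow>
    (\<forall>c. (\<forall>b\<in>B. c b \<in> K) \<longrightarrow> (\<Sum>b\<in>B. c b * b) = 0 \<longrightarrow> (\<forall>b\<in>B. c b = 0))"

text \<open>Expanding each element of \<open>B\<close> in \<open>S\<close>, a relation among
  \<open>B\<close> follows from \<open>card S\<close> linear equations in \<open>card B\<close>
  unknowns. If there were more unknowns than equations, a nontrivial solution would contradict
  independence.\<close>

lemma card_independent_le:
  assumes K: "subfield K" and S: "finite S" and B: "finite B" "B \<subseteq> kspan K S"
    and ind: "independent_over K B"
  shows "card B \<le> card S"
proof (rule ccontr)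
  assume "\<not> card B \<le> card S"
  have "\<forall>b\<in>B. \<exists>c. b = (\<Sum>s\<in>S. c s * s) \<and> (\<forall>s\<in>S. c s \<in> K)"
    using B unfolding kspan_finite[OF K S] by blast
  then obtain a where a: "\<And>b. b \<in> B \<Longrightarrow> b = (\<Sum>s\<in>S. a b s * s)"
    "\<And>b s. b \<in> B \<Longrightarrow> s \<in> S \<Longrightarrow> a b s \<in> K" by metis
  obtain c where c: "\<forall>b\<in>B. c b \<in> K" "\<exists>b\<in>B. c b \<noteq> 0" "\<forall>s\<in>S. (\<Sum>b\<in>B. c b * a b s) = 0"
    using homogeneous_system_solution[OF K S B(1), of a] a(2) \<open>\<not> card B \<le> card S\<close> by auto
  have "(\<Sum>b\<in>B. c b * b) = (\<Sum>b\<in>B. \<Sum>s\<in>S. c b * a b s * s)"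
    by (rule sum.cong[OF refl], subst a(1)) (auto simp: sum_distrib_left mult.assoc)
  also have "\<dots> = (\<Sum>s\<in>S. (\<Sum>b\<in>B. c b * a b s) * s)"
    by (subst sum.swap) (simp add: sum_distrib_right)
  also have "\<dots> = 0" using c by simp
  finally show False using ind c unfolding independent_over_def by blast
qed

definition basis_over :: "'a::field set \<Rightarrow> 'a set \<Rightarrow> 'a set \<Rightarrow> bool" where
  "basis_over K E B \<longleftrightarrow> finite B \<and> B \<subseteq> E \<and> E \<subseteq> kspan K B \<and> independent_over K B"

text \<open>\<open>ext_degree\<close> is the least size of a spanning set, and by
  \<open>card_independent_le\<close> no spanning set is smaller than an independent one.\<close>

lemma ext_degree_basis:
  assumes "subfield K" "basis_over K E B"
  shows "finite_ext K E" "ext_degree K E = card B"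
proof -
  show "finite_ext K E" using assms by (auto simp: finite_ext_def basis_over_def)
  show "ext_degree K E = card B"
    unfolding ext_degree_def
  proof (rule Least_equality)
    show "\<exists>S. finite S \<and> card S = card B \<and> S \<subseteq> E \<and> E \<subseteq> kspan K S"
      using assms by (auto simp: basis_over_def)
  next
    fix n assume "\<exists>S. finite S \<and> card S = n \<and> S \<subseteq> E \<and> E \<subseteq> kspan K S"
    then obtain S where S: "finite S" "card S = n" "E \<subseteq> kspan K S" by blast
    then have "B \<subseteq> kspan K S" using assms by (auto simp: basis_over_def)
    then show "card B \<le> n"
      using card_independent_le[OF assms(1) S(1)] S(2) assms(2) by (auto simp: basis_over_def)
  qed
qed

lemma basis_over_one:
  assumes K: "subfield K"
  shows "basis_over K K {1}"
  using subfieldD(2)[OF K] by (auto simp: basis_over_def independent_over_def kspan_finite[OF K])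

text \<open>The tower law for one quadratic step. A relation over \<open>K\<close> has the form
  \<open>u + v * z = 0\<close> with \<open>u, v \<in> E\<close>; since \<open>z \<notin> E\<close>,
  both \<open>u\<close> and \<open>v\<close> vanish, and independence of \<open>B\<close> applies to
  each.\<close>

lemma basis_over_adjoin_square_root:
  assumes K: "subfield K" and E: "subfield E" "K \<subseteq> E" and B: "basis_over K E B"
    and z: "z * z \<in> E" "z \<notin> E"
  shows "basis_over K (adjoin E {z}) (B \<union> (\<lambda>b. b * z) ` B)"
    "card (B \<union> (\<lambda>b. b * z) ` B) = 2 * card B"
proof -
  note f = subfieldD[OF E(1)]
  have fin: "finite B" and BE: "B \<subseteq> E" and sp: "E \<subseteq> kspan K B" and ind: "independent_over K B"
    using B by (auto simp: basis_over_def)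
  have z0: "z \<noteq> 0" using z f(1) by auto
  \<comment> \<open>The indicator of 0 would be a nontrivial relation. This permits the division
    that separates \<open>B\<close> from its multiple by \<open>z\<close>.\<close>
  have B0: "0 \<notin> B"
  proof
    assume "0 \<in> B"
    define c where "c b = (if b = 0 then 1 else 0 :: 'a)" for b :: 'a
    have "(\<Sum>b\<in>B. c b * b) = 0" by (intro sum.neutral) (auto simp: c_def)
    moreover have "\<forall>b\<in>B. c b \<in> K" using subfieldD(1,2)[OF K] by (auto simp: c_def)
    ultimately have "c 0 = 0" using ind \<open>0 \<in> B\<close> unfolding independent_over_def by blast
    then show False by (simp add: c_def)
  qed
  have inj: "inj_on (\<lambda>b. b * z) B" using z0 by (auto intro: inj_onI)
  have disj: "B \<inter> (\<lambda>b. b * z) ` B = {}"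
  proof (rule ccontr)
    assume "B \<inter> (\<lambda>b. b * z) ` B \<noteq> {}"
    then obtain b b' where b: "b \<in> B" "b' \<in> B" "b = b' * z" by blast
    then have "z = b / b'" using B0 by auto
    then show False using b BE f(8) z(2) by blast
  qed
  have split: "(\<Sum>b\<in>B \<union> (\<lambda>b. b * z) ` B. c b * b) =
      (\<Sum>b\<in>B. c b * b) + (\<Sum>b\<in>B. c (b * z) * b) * z" for c
    using fin disj inj
    by (simp add: sum.union_disjoint sum.reindex sum_distrib_right mult.assoc)
  have eq: "adjoin E {z} = {u + v * z | u v. u \<in> E \<and> v \<in> E}"
    using E(1) z(1) by (rule adjoin_square_root)
  show "card (B \<union> (\<lambda>b. b * z) ` B) = 2 * card B"
    using fin disj inj by (simp add: card_Un_disjoint card_image)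
  have "adjoin E {z} \<subseteq> kspan K (B \<union> (\<lambda>b. b * z) ` B)"
  proof
    fix x assume "x \<in> adjoin E {z}"
    then obtain u v where x: "x = u + v * z" "u \<in> E" "v \<in> E" using eq by blast
    then obtain c d where c: "u = (\<Sum>b\<in>B. c b * b)" "\<forall>b\<in>B. c b \<in> K"
      and d: "v = (\<Sum>b\<in>B. d b * b)" "\<forall>b\<in>B. d b \<in> K"
      using sp unfolding kspan_finite[OF K fin] by blast
    \<comment> \<open>The two halves are disjoint, so one coefficient function can carry the
      coordinates of \<open>u\<close> on \<open>B\<close> and those of \<open>v\<close> on the
      elements \<open>b * z\<close>.\<close>
    define e where "e b = (if b \<in> B then c b else d (b / z))" for b
    have "(\<Sum>b\<in>B. e b * b) = u" unfolding c by (rule sum.cong) (auto simp: e_def)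
    moreover have "(\<Sum>b\<in>B. e (b * z) * b) = v"
      unfolding d by (rule sum.cong) (use disj z0 in \<open>auto simp: e_def\<close>)
    ultimately have "x = (\<Sum>b\<in>B \<union> (\<lambda>b. b * z) ` B. e b * b)"
      using x split by simp
    moreover have "\<forall>b\<in>B \<union> (\<lambda>b. b * z) ` B. e b \<in> K"
      using c d z0 by (auto simp: e_def)
    ultimately show "x \<in> kspan K (B \<union> (\<lambda>b. b * z) ` B)"
      using fin by (auto simp: kspan_finite[OF K])
  qed
  moreover have "independent_over K (B \<union> (\<lambda>b. b * z) ` B)"
    unfolding independent_over_def
  proof (intro allI impI)
    fix c assume c: "\<forall>b\<in>B \<union> (\<lambda>b. b * z) ` B. c b \<in> K"
      and "(\<Sum>b\<in>B \<union> (\<lambda>b. b * z) ` B. c b * b) = 0"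
    define u v where "u = (\<Sum>b\<in>B. c b * b)" and "v = (\<Sum>b\<in>B. c (b * z) * b)"
    have 0: "u + v * z = 0" using \<open>_ = 0\<close> by (simp add: split u_def v_def)
    have uv: "u \<in> E" "v \<in> E"
      unfolding u_def v_def using c BE E(2) by (auto intro!: subfield_sum[OF E(1)] f(4))
    have "v = 0"
    proof (rule ccontr)
      assume "v \<noteq> 0"
      then have "z = (- u) / v" using 0 by (simp add: eq_neg_iff_add_eq_0 field_simps)
      then show False using f(8)[OF f(5)[OF uv(1)] uv(2)] z(2) by simp
    qed
    then have "u = 0" using 0 by simp
    have i: "\<forall>b\<in>B. d b = 0" if "\<forall>b\<in>B. d b \<in> K" "(\<Sum>b\<in>B. d b * b) = 0" for d
      using ind that unfolding independent_over_def by blast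
    have "\<forall>b\<in>B. c b = 0" "\<forall>b\<in>B. c (b * z) = 0"
      using i[of c] i[of "\<lambda>b. c (b * z)"] c \<open>u = 0\<close> \<open>v = 0\<close> unfolding u_def v_def by auto
    then show "\<forall>b\<in>B \<union> (\<lambda>b. b * z) ` B. c b = 0" by auto
  qed
  moreover have "B \<union> (\<lambda>b. b * z) ` B \<subseteq> adjoin E {z}"
    using BE adjoin_superset[of E "{z}"] by (auto intro!: subfieldD(4)[OF subfield_adjoin])
  ultimately show "basis_over K (adjoin E {z}) (B \<union> (\<lambda>b. b * z) ` B)"
    using fin by (auto simp: basis_over_def)
qed

lemma quad_ext_adjoin_square_root:
  assumes M: "subfield M" and z: "z * z \<in> M" "z \<notin> M"
  shows "quad_ext M (adjoin M {z})"
proof -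
  note b = basis_over_adjoin_square_root[OF M M _ basis_over_one[OF M] z, simplified]
  show ?thesis
    using ext_degree_basis[OF M b(1)] b(2) M adjoin_superset[of M "{z}"]
    by (simp add: quad_ext_def)
qed

text \<open>Completing the square.\<close>

lemma quad_ext_imp_square_root:
  fixes M :: "'a::field set"
  assumes E: "quad_ext M E" and two: "(2::'a) \<noteq> 0"
  obtains z where "z * z \<in> M" "z \<notin> M" "E = adjoin M {z}"
proof -
  have M: "subfield M" "subfield E" "M \<subseteq> E" "finite_ext M E" "ext_degree M E = 2"
    using E by (auto simp: quad_ext_def)
  note f = subfieldD[OF M(1)] and g = subfieldD[OF M(2)]
  have "\<exists>n S. finite S \<and> card S = n \<and> S \<subseteq> E \<and> E \<subseteq> kspan M S"
    using M(4) by (auto simp: finite_ext_def)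
  then have "\<exists>S. finite S \<and> card S = 2 \<and> S \<subseteq> E \<and> E \<subseteq> kspan M S"
    using LeastI_ex[of "\<lambda>n. \<exists>S. finite S \<and> card S = n \<and> S \<subseteq> E \<and> E \<subseteq> kspan M S"] M(5)
    unfolding ext_degree_def by auto
  then obtain S where S: "finite S" "card S = 2" "E \<subseteq> kspan M S" by blast
  \<comment> \<open>Two elements span \<open>E\<close>, so any three are dependent; this is applied
    to \<open>1\<close>, \<open>x\<close> and \<open>e\<close>.\<close>
  have dep: "\<exists>c. (\<forall>t\<in>T. c t \<in> M) \<and> (\<Sum>t\<in>T. c t * t) = 0 \<and> (\<exists>t\<in>T. c t \<noteq> 0)"
    if "finite T" "card T = 3" "T \<subseteq> E" for T
    using card_independent_le[OF M(1) S(1) that(1)] that S unfolding independent_over_def by auto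
  have "E \<noteq> M"
    using ext_degree_basis(2)[OF M(1) basis_over_one[OF M(1)]] M(5) by auto
  then obtain x where x: "x \<in> E" "x \<notin> M" using M(3) by blast
  have quad: "\<exists>u\<in>M. \<exists>v\<in>M. e = u + v * x" if e: "e \<in> E" for e
  proof (cases "e \<in> {1, x}")
    case True
    then show ?thesis
    proof
      assume "e = 1"
      then show ?thesis using f(1,2) by (intro bexI[of _ 1] bexI[of _ 0]) auto
    next
      assume "e \<in> {x}"
      then show ?thesis using f(1,2) by (intro bexI[of _ 0] bexI[of _ 1]) auto
    qed
  next
    case False
    moreover have "x \<noteq> 1" using x f by auto
    ultimately have d: "card {1, x, e} = 3" "{1, x, e} \<subseteq> E" using e x g by auto
    obtain c where c: "c 1 \<in> M" "c x \<in> M" "c e \<in> M" "c 1 \<noteq> 0 \<or> c x \<noteq> 0 \<or> c e \<noteq> 0"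
      "(\<Sum>t\<in>{1, x, e}. c t * t) = 0"
      using dep[OF _ d] by auto
    then have s: "c 1 + c x * x + c e * e = 0"
    proof -
      have "1 \<notin> {x, e}" "x \<notin> {e}" using False \<open>x \<noteq> 1\<close> by auto
      then have "(\<Sum>t\<in>{1, x, e}. c t * t) = c 1 + c x * x + c e * e" by (simp add: add.assoc)
      then show ?thesis using c(5) by simp
    qed
    have "c e \<noteq> 0"
    proof
      assume c0: "c e = 0"
      then have "c x \<noteq> 0" using s c by auto
      then have "x = (- c 1) / c x" using s c0 by (simp add: eq_neg_iff_add_eq_0 field_simps)
      then show False using f(8)[OF f(5)[OF c(1)] c(2)] x(2) by simp
    qed
    then have "e = - (c 1 + c x * x) / c e"
      using s by (metis add.inverse_inverse eq_neg_iff_add_eq_0 minus_divide_left mult.commute nonzero_mult_div_cancel_left)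
    then have "e = (- c 1) / c e + (- c x) / c e * x"
      by (simp add: add_divide_distrib diff_divide_distrib)
    then show ?thesis using f(8)[OF f(5) c(3)] c(1,2) by blast
  qed
  obtain u v where uv: "u \<in> M" "v \<in> M" "x * x = u + v * x" using quad[OF g(4)[OF x(1) x(1)]] by blast
  have two_M: "2 \<in> M" using f(3)[OF f(2) f(2)] by simp
  \<comment> \<open>Half the linear coefficient of \<open>x * x = u + v * x\<close>; characteristic
    not 2 enters here.\<close>
  define h where "h = v / 2"
  have h: "h \<in> M" "v = h + h" using uv two_M f two by (auto simp: h_def)
  define z where "z = x - h"
  have "z * z = u + h * h" using uv h by (simp add: z_def algebra_simps)
  then have z1: "z * z \<in> M" using uv h f by auto
  have xz: "x = h + z" by (simp add: z_def)
  have z2: "z \<notin> M" using x(2) h(1) f(3) xz by auto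
  have "E \<subseteq> adjoin M {z}"
  proof
    fix e assume "e \<in> E"
    then obtain u v where uv: "u \<in> M" "v \<in> M" "e = u + v * x" using quad by blast
    then have "e = (u + v * h) + v * z" by (simp add: xz algebra_simps)
    moreover have "u + v * h \<in> M" using uv h f by auto
    ultimately show "e \<in> adjoin M {z}" using adjoin_square_root[OF M(1) z1] uv by blast
  qed
  moreover have "adjoin M {z} \<subseteq> E"
    using M x h g(7) by (intro adjoin_least) (auto simp: z_def)
  ultimately show ?thesis using that z1 z2 by blast
qed

section \<open>Extension of homomorphisms\<close>

text \<open>The intersection provides an induction principle: a property holds on the whole closure
  once the elements having it form a subfield that contains \<open>F\<close> and is closed under
  square roots.\<close>

definition sqrt_closure :: "'a::field set \<Rightarrow> 'a set" where
  "sqrt_closure F = \<Inter>{K. subfield K \<and> F \<subseteq> K \<and> (\<forall>z. z * z \<in> K \<longrightarrow> z \<in> K)}"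

text \<open>Graphs of field embeddings: the condition on 0 makes the relation single-valued.
  On graphs, a chain of partial homomorphisms has its union as an upper bound.\<close>

definition hom_graph :: "('a::field \<times> 'a) set \<Rightarrow> bool" where
  "hom_graph \<Gamma> \<longleftrightarrow> (1, 1) \<in> \<Gamma> \<and>
    (\<forall>x x' y y'. (x, x') \<in> \<Gamma> \<longrightarrow> (y, y') \<in> \<Gamma> \<longrightarrow> (x + y, x' + y') \<in> \<Gamma> \<and> (x * y, x' * y') \<in> \<Gamma>) \<and>
    (\<forall>x x'. (x, x') \<in> \<Gamma> \<longrightarrow> (- x, - x') \<in> \<Gamma> \<and> (inverse x, inverse x') \<in> \<Gamma>) \<and>
    (\<forall>y. (0, y) \<in> \<Gamma> \<longrightarrow> y = 0)"

lemma hom_graphD: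
  assumes "hom_graph \<Gamma>"
  shows "(1, 1) \<in> \<Gamma>" "(x, x') \<in> \<Gamma> \<Longrightarrow> (y, y') \<in> \<Gamma> \<Longrightarrow> (x + y, x' + y') \<in> \<Gamma>"
    "(x, x') \<in> \<Gamma> \<Longrightarrow> (y, y') \<in> \<Gamma> \<Longrightarrow> (x * y, x' * y') \<in> \<Gamma>"
    "(x, x') \<in> \<Gamma> \<Longrightarrow> (- x, - x') \<in> \<Gamma>" "(x, x') \<in> \<Gamma> \<Longrightarrow> (inverse x, inverse x') \<in> \<Gamma>"
    "(0, y) \<in> \<Gamma> \<Longrightarrow> y = 0"
  using assms by (simp_all add: hom_graph_def)

lemma hom_graph_zero: "hom_graph \<Gamma> \<Longrightarrow> (0, 0) \<in> \<Gamma>"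
  using hom_graphD(2)[OF _ hom_graphD(1) hom_graphD(4)[OF _ hom_graphD(1)]] by fastforce

lemma hom_graph_diff: "hom_graph \<Gamma> \<Longrightarrow> (x, x') \<in> \<Gamma> \<Longrightarrow> (y, y') \<in> \<Gamma> \<Longrightarrow> (x - y, x' - y') \<in> \<Gamma>"
  using hom_graphD(2)[of \<Gamma> x x' "- y" "- y'"] hom_graphD(4)[of \<Gamma> y y'] by simp

lemma hom_graph_functional:
  assumes "hom_graph \<Gamma>" "(x, y) \<in> \<Gamma>" "(x, y') \<in> \<Gamma>"
  shows "y = y'"
  using hom_graphD(6)[OF assms(1), of "y - y'"] hom_graph_diff[OF assms] by simp

lemma hom_graph_injective:
  assumes "hom_graph \<Gamma>" "(x, 0) \<in> \<Gamma>"
  shows "x = 0"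
proof (rule ccontr)
  assume "x \<noteq> 0"
  then have "(1, 0) \<in> \<Gamma>"
    using hom_graphD(3)[OF assms(1) assms(2) hom_graphD(5)[OF assms]] by simp
  then show False using hom_graph_functional[OF assms(1) hom_graphD(1)[OF assms(1)]] by fastforce
qed

lemma subfield_hom_graph_domain:
  assumes "hom_graph \<Gamma>"
  shows "subfield (fst ` \<Gamma>)"
proof (rule subfieldI)
  show "1 \<in> fst ` \<Gamma>" using hom_graphD(1)[OF assms] by force
next
  fix x y assume "x \<in> fst ` \<Gamma>" "y \<in> fst ` \<Gamma>"
  then obtain x' y' where "(x, x') \<in> \<Gamma>" "(y, y') \<in> \<Gamma>" by force
  then show "x + y \<in> fst ` \<Gamma>" "x * y \<in> fst ` \<Gamma>"
    using hom_graphD(2,3)[OF assms, of x x' y y'] by force+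
next
  fix x assume "x \<in> fst ` \<Gamma>"
  then obtain x' where "(x, x') \<in> \<Gamma>" by force
  then show "- x \<in> fst ` \<Gamma>" "inverse x \<in> fst ` \<Gamma>"
    using hom_graphD(4,5)[OF assms, of x x'] by force+
qed

text \<open>Here \<open>z'\<close> may be either square root of the image of \<open>z * z\<close>.
  Since \<open>z\<close> lies outside the domain, norms of nonzero elements are nonzero; this gives
  inverses and makes 0 have only the image 0.\<close>

lemma hom_graph_adjoin_square_root:
  assumes \<Gamma>: "hom_graph \<Gamma>" and y: "(z * z, z' * z') \<in> \<Gamma>" and z: "z \<notin> fst ` \<Gamma>"
  defines "\<Delta> \<equiv> {(u + v * z, u' + v' * z') | u u' v v'. (u, u') \<in> \<Gamma> \<and> (v, v') \<in> \<Gamma>}"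
  shows "hom_graph \<Delta>" "\<Gamma> \<subseteq> \<Delta>" "(z, z') \<in> \<Delta>" "fst ` \<Delta> \<subseteq> adjoin (fst ` \<Gamma>) {z}"
proof -
  note g = hom_graphD[OF \<Gamma>] and g0 = hom_graph_zero[OF \<Gamma>]
  have D: "(x, x') \<in> \<Delta>" if "(u, u') \<in> \<Gamma>" "(v, v') \<in> \<Gamma>" "x = u + v * z" "x' = u' + v' * z'"
    for x x' u u' v v'
    unfolding \<Delta>_def using that by blast
  have DE: "\<exists>u u' v v'. (u, u') \<in> \<Gamma> \<and> (v, v') \<in> \<Gamma> \<and> x = u + v * z \<and> x' = u' + v' * z'"
    if "(x, x') \<in> \<Delta>" for x x'
    using that unfolding \<Delta>_def by blast
  have sub: "subfield (fst ` \<Gamma>)" by (rule subfield_hom_graph_domain[OF \<Gamma>])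
  show G\<Delta>: "\<Gamma> \<subseteq> \<Delta>"
  proof
    fix p assume "p \<in> \<Gamma>"
    then show "p \<in> \<Delta>" by (cases p) (auto intro: D[OF _ g0])
  qed
  show "(z, z') \<in> \<Delta>" by (rule D[OF g0 g(1)]) auto
  show "fst ` \<Delta> \<subseteq> adjoin (fst ` \<Gamma>) {z}"
  proof
    fix x assume "x \<in> fst ` \<Delta>"
    then obtain u v where "x = u + v * z" "u \<in> fst ` \<Gamma>" "v \<in> fst ` \<Gamma>"
      unfolding \<Delta>_def by force
    moreover have "z * z \<in> fst ` \<Gamma>" using y by force
    ultimately show "x \<in> adjoin (fst ` \<Gamma>) {z}" using adjoin_square_root[OF sub] by blast
  qed
  show "hom_graph \<Delta>"
    unfolding hom_graph_def
  proof (intro conjI allI impI)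
    show "(1, 1) \<in> \<Delta>" using g(1) G\<Delta> by blast
  next
    fix x x' w w' assume "(x, x') \<in> \<Delta>" "(w, w') \<in> \<Delta>"
    then obtain u u' v v' p p' q q' where
      x: "(u, u') \<in> \<Gamma>" "(v, v') \<in> \<Gamma>" "x = u + v * z" "x' = u' + v' * z'" and
      w: "(p, p') \<in> \<Gamma>" "(q, q') \<in> \<Gamma>" "w = p + q * z" "w' = p' + q' * z'"
      using DE by meson
    show "(x + w, x' + w') \<in> \<Delta>"
      by (rule D[OF g(2)[OF x(1) w(1)] g(2)[OF x(2) w(2)]]) (simp_all add: x w algebra_simps)
    show "(x * w, x' * w') \<in> \<Delta>"
      by (rule D[OF g(2)[OF g(3)[OF x(1) w(1)] g(3)[OF g(3)[OF x(2) w(2)] y]]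
            g(2)[OF g(3)[OF x(1) w(2)] g(3)[OF x(2) w(1)]]]) (simp_all add: x w algebra_simps)
  next
    fix x x' assume "(x, x') \<in> \<Delta>"
    then obtain u u' v v' where
      x: "(u, u') \<in> \<Gamma>" "(v, v') \<in> \<Gamma>" "x = u + v * z" "x' = u' + v' * z'"
      using DE by meson
    show "(- x, - x') \<in> \<Delta>"
      by (rule D[OF g(4)[OF x(1)] g(4)[OF x(2)]]) (simp_all add: x)
    show "(inverse x, inverse x') \<in> \<Delta>"
    proof (cases "u = 0 \<and> v = 0")
      case True
      then have "u' = 0 \<and> v' = 0" using x(1,2) g(6) by blast
      then show ?thesis using True x g0 G\<Delta> by auto
    next
      case False
      define n n' where "n = u * u - v * v * (z * z)" and "n' = u' * u' - v' * v' * (z' * z')"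
      \<comment> \<open>The norm is mapped to the corresponding norm, which is nonzero by
        injectivity, so the denominator can be rationalised on both sides.\<close>
      have n: "(n, n') \<in> \<Gamma>"
        unfolding n_def n'_def by (intro hom_graph_diff[OF \<Gamma>] g(3) x y)
      have "u \<in> fst ` \<Gamma>" "v \<in> fst ` \<Gamma>" using x by force+
      then have n0: "n \<noteq> 0"
        unfolding n_def using quadratic_norm_nonzero[OF sub z] False by blast
      then have n0': "n' \<noteq> 0" using hom_graph_injective[OF \<Gamma>] n by auto
      show ?thesis
      proof (rule D[OF g(3)[OF x(1) g(5)[OF n]] g(4)[OF g(3)[OF x(2) g(5)[OF n]]]])
        show "inverse x = u * inverse n + - (v * inverse n) * z"
          unfolding x(3) by (rule inverse_quadratic[OF n_def n0])
        show "inverse x' = u' * inverse n' + - (v' * inverse n') * z'"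
          unfolding x(4) by (rule inverse_quadratic[OF n'_def n0'])
      qed
    qed
  next
    fix x' assume "(0, x') \<in> \<Delta>"
    then obtain u u' v v' where
      x: "(u, u') \<in> \<Gamma>" "(v, v') \<in> \<Gamma>" "0 = u + v * z" "x' = u' + v' * z'"
      using DE by meson
    have uv: "u \<in> fst ` \<Gamma>" "v \<in> fst ` \<Gamma>" using x by force+
    have "u * u - v * v * (z * z) = (u + v * z) * (u - v * z)" by (simp add: algebra_simps)
    also have "\<dots> = 0" using x(3) by simp
    finally have "u = 0" "v = 0" using quadratic_norm_nonzero[OF sub z uv] by blast+
    then have "u' = 0" "v' = 0" using x(1,2) g(6) by blast+
    then show "x' = 0" using x(4) by simp
  qed
qed

lemma chain_Union_common:
  assumes "subset.chain \<A> \<C>" "p \<in> \<Union>\<C>" "q \<in> \<Union>\<C>"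
  shows "\<exists>X\<in>\<C>. p \<in> X \<and> q \<in> X"
proof -
  obtain X Y where XY: "X \<in> \<C>" "Y \<in> \<C>" "p \<in> X" "q \<in> Y" using assms(2,3) by blast
  then have "X \<subseteq> Y \<or> Y \<subseteq> X" using assms(1) by (simp add: subset_chain_def)
  then show ?thesis using XY by blast
qed

lemma Id_on_mono: "A \<subseteq> B \<Longrightarrow> Id_on A \<subseteq> Id_on B"
  by (auto simp: Id_on_def)

locale quadratic_base =
  fixes F :: "'a::alg_closed_field set"
  assumes F: "subfield F" and two: "(2::'a) \<noteq> 0"
begin

abbreviation "Q \<equiv> sqrt_closure F"

lemma Q: "subfield Q"
  unfolding sqrt_closure_def by (rule subfield_Inter) auto

lemma F_subset_Q: "F \<subseteq> Q"
  unfolding sqrt_closure_def by blast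

lemma Q_sqrt: "z * z \<in> Q \<Longrightarrow> z \<in> Q"
  unfolding sqrt_closure_def by blast

lemma Q_least: "subfield K \<Longrightarrow> F \<subseteq> K \<Longrightarrow> (\<And>z. z * z \<in> K \<Longrightarrow> z \<in> K) \<Longrightarrow> Q \<subseteq> K"
  unfolding sqrt_closure_def by blast

lemma adjoin_subset_Q: "K \<subseteq> Q \<Longrightarrow> z * z \<in> Q \<Longrightarrow> adjoin K {z} \<subseteq> Q"
  by (rule adjoin_least[OF Q]) (auto intro: Q_sqrt)

text \<open>Only the values on \<open>Q\<close> matter; on \<open>Q\<close> these maps turn out to be automorphisms.\<close>

definition gal :: "'a set \<Rightarrow> ('a \<Rightarrow> 'a) set" where
  "gal K = {\<sigma>. (\<forall>x\<in>Q. \<forall>y\<in>Q. \<sigma> (x + y) = \<sigma> x + \<sigma> y \<and> \<sigma> (x * y) = \<sigma> x * \<sigma> y) \<and> (\<forall>x\<in>K. \<sigma> x = x)}"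

lemma sqrt_exists: "\<exists>z::'a. z * z = y"
  using nth_root_exists[of 2 y] by (auto simp: power2_eq_square)

text \<open>By Zorn there is a maximal extension with domain inside \<open>Q\<close>. Its domain is
  closed under square roots, since otherwise one more root could be adjoined, and so it is all of
  \<open>Q\<close>.\<close>

lemma hom_graph_extends:
  assumes \<Gamma>: "hom_graph \<Gamma>" "fst ` \<Gamma> \<subseteq> Q" "Id_on F \<subseteq> \<Gamma>"
  obtains \<sigma> where "\<sigma> \<in> gal F" "\<And>x x'. (x, x') \<in> \<Gamma> \<Longrightarrow> \<sigma> x = x'"
proof -
  define \<A> where "\<A> = {\<Delta>. hom_graph \<Delta> \<and> fst ` \<Delta> \<subseteq> Q \<and> \<Gamma> \<subseteq> \<Delta>}"
  have "\<exists>\<Delta>\<in>\<A>. \<forall>X\<in>\<A>. \<Delta> \<subseteq> X \<longrightarrow> X = \<Delta>"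
  proof (rule subset_Zorn_nonempty)
    show "\<A> \<noteq> {}" using \<Gamma> by (auto simp: \<A>_def)
  next
    fix \<C> assume "\<C> \<noteq> {}" and ch: "subset.chain \<A> \<C>"
    have mem: "hom_graph X" "fst ` X \<subseteq> Q" "\<Gamma> \<subseteq> X" if "X \<in> \<C>" for X
      using ch that by (auto simp: subset.chain_def \<A>_def)
    have common: "\<exists>X\<in>\<C>. p \<in> X \<and> q \<in> X" if "p \<in> \<Union>\<C>" "q \<in> \<Union>\<C>" for p q
      using that by (rule chain_Union_common[OF ch])
    have "hom_graph (\<Union>\<C>)"
      unfolding hom_graph_def
    proof (intro conjI allI impI)
      show "(1, 1) \<in> \<Union>\<C>" using \<open>\<C> \<noteq> {}\<close> hom_graphD(1)[OF mem(1)] by blast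
    next
      fix x x' y y' assume "(x, x') \<in> \<Union>\<C>" "(y, y') \<in> \<Union>\<C>"
      then obtain X where "X \<in> \<C>" "(x, x') \<in> X" "(y, y') \<in> X" using common by blast
      then show "(x + y, x' + y') \<in> \<Union>\<C>" "(x * y, x' * y') \<in> \<Union>\<C>"
        using hom_graphD(2,3)[OF mem(1)] by blast+
    next
      fix x x' assume "(x, x') \<in> \<Union>\<C>"
      then show "(- x, - x') \<in> \<Union>\<C>" "(inverse x, inverse x') \<in> \<Union>\<C>"
        using hom_graphD(4,5)[OF mem(1)] by blast+
    next
      fix y assume "(0, y) \<in> \<Union>\<C>"
      then show "y = 0" using hom_graphD(6)[OF mem(1)] by blast
    qed
    moreover have "fst ` \<Union>\<C> \<subseteq> Q" using mem(2) by blast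
    moreover have "\<Gamma> \<subseteq> \<Union>\<C>" using mem(3) \<open>\<C> \<noteq> {}\<close> by blast
    ultimately show "\<Union>\<C> \<in> \<A>" by (simp add: \<A>_def)
  qed
  then obtain \<Delta> where \<Delta>: "hom_graph \<Delta>" "fst ` \<Delta> \<subseteq> Q" "\<Gamma> \<subseteq> \<Delta>"
    and max: "\<And>X. X \<in> \<A> \<Longrightarrow> \<Delta> \<subseteq> X \<Longrightarrow> X = \<Delta>"
    by (auto simp: \<A>_def)
  have "Q \<subseteq> fst ` \<Delta>"
  proof (rule Q_least)
    show "subfield (fst ` \<Delta>)" by (rule subfield_hom_graph_domain[OF \<Delta>(1)])
    show "F \<subseteq> fst ` \<Delta>" using \<Gamma>(3) \<Delta>(3) by force
  next
    fix z assume "z * z \<in> fst ` \<Delta>"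
    then obtain y' where y': "(z * z, y') \<in> \<Delta>" by force
    obtain z' where z': "z' * z' = y'" using sqrt_exists by blast
    show "z \<in> fst ` \<Delta>"
    proof (rule ccontr)
      assume z: "z \<notin> fst ` \<Delta>"
      have y: "(z * z, z' * z') \<in> \<Delta>" using y' z' by simp
      note ext = hom_graph_adjoin_square_root[OF \<Delta>(1) y z]
      have "z * z \<in> Q" using y \<Delta>(2) by force
      then have "adjoin (fst ` \<Delta>) {z} \<subseteq> Q" using adjoin_subset_Q[OF \<Delta>(2)] by blast
      \<comment> \<open>By maximality the one-step extension coincides with
        \<open>\<Delta>\<close>.\<close>
      then have "(z, z') \<in> \<Delta>"
        using ext(1,3,4) max[OF _ ext(2)] order_trans[OF \<Delta>(3) ext(2)]
        unfolding \<A>_def by (metis (mono_tags, lifting) mem_Collect_eq order_trans)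
      then show False using z by force
    qed
  qed
  then have ex: "\<exists>x'. (x, x') \<in> \<Delta>" if "x \<in> Q" for x using that by force
  define \<sigma> where "\<sigma> x = (THE x'. (x, x') \<in> \<Delta>)" for x
  have \<sigma>: "\<sigma> x = x'" if "(x, x') \<in> \<Delta>" for x x'
    unfolding \<sigma>_def using that hom_graph_functional[OF \<Delta>(1)] by blast
  have "\<sigma> \<in> gal F"
    unfolding gal_def
  proof (intro CollectI conjI ballI)
    fix x y assume "x \<in> Q" "y \<in> Q"
    then obtain x' y' where "(x, x') \<in> \<Delta>" "(y, y') \<in> \<Delta>" using ex by blast
    then show "\<sigma> (x + y) = \<sigma> x + \<sigma> y" "\<sigma> (x * y) = \<sigma> x * \<sigma> y"
      using \<sigma> hom_graphD(2,3)[OF \<Delta>(1)] by metis+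
  next
    fix x assume "x \<in> F"
    then show "\<sigma> x = x" using \<Gamma>(3) \<Delta>(3) by (intro \<sigma>) (auto simp: Id_on_def)
  qed
  then show ?thesis using that \<sigma> \<Delta>(3) by blast
qed

section \<open>Galois theory of the square root closure\<close>

lemma gal_antimono: "K \<subseteq> L \<Longrightarrow> gal L \<subseteq> gal K"
  by (auto simp: gal_def)

lemma galD:
  assumes "\<sigma> \<in> gal F"
  shows "x \<in> Q \<Longrightarrow> y \<in> Q \<Longrightarrow> \<sigma> (x + y) = \<sigma> x + \<sigma> y" "x \<in> Q \<Longrightarrow> y \<in> Q \<Longrightarrow> \<sigma> (x * y) = \<sigma> x * \<sigma> y"
    "x \<in> F \<Longrightarrow> \<sigma> x = x"
  using assms by (auto simp: gal_def)

lemma gal_minus: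
  assumes "\<sigma> \<in> gal F" "x \<in> Q"
  shows "\<sigma> (- x) = - \<sigma> x"
  using galD(2)[OF assms(1), of "- 1" x] galD(3)[OF assms(1), of "- 1"] assms(2)
    subfieldD(2,5)[OF F] subfieldD(2,5)[OF Q] by simp

lemma gal_eq_0:
  assumes "\<sigma> \<in> gal F" "x \<in> Q" "\<sigma> x = 0"
  shows "x = 0"
proof (rule ccontr)
  assume "x \<noteq> 0"
  then have "\<sigma> 1 = \<sigma> x * \<sigma> (inverse x)"
    using galD(2)[OF assms(1), of x "inverse x"] assms(2) subfieldD(6)[OF Q] by simp
  then show False using assms(3) galD(3)[OF assms(1)] subfieldD(2)[OF F] by simp
qed

lemma gal_inverse:
  assumes "\<sigma> \<in> gal F" "x \<in> Q"
  shows "\<sigma> (inverse x) = inverse (\<sigma> x)"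
proof (cases "x = 0")
  case True
  then show ?thesis using galD(3)[OF assms(1)] subfieldD(1)[OF F] by simp
next
  case False
  then have "\<sigma> x * \<sigma> (inverse x) = 1"
    using galD(2)[OF assms(1), of x "inverse x"] assms subfieldD(6)[OF Q] galD(3)[OF assms(1)]
      subfieldD(2)[OF F] by simp
  then show ?thesis by (metis inverse_unique)
qed

lemma gal_inj:
  assumes "\<sigma> \<in> gal F"
  shows "inj_on \<sigma> Q"
proof (rule inj_onI)
  fix x y assume "x \<in> Q" "y \<in> Q" "\<sigma> x = \<sigma> y"
  then have "\<sigma> (x - y) = 0"
    using galD(1)[OF assms, of x "- y"] gal_minus[OF assms] subfieldD(5)[OF Q] by simp
  then show "x = y" using gal_eq_0[OF assms] subfieldD(7)[OF Q] \<open>x \<in> Q\<close> \<open>y \<in> Q\<close> by fastforce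
qed

text \<open>With this, inclusions of images need to be checked on generators only.\<close>

lemma subfield_gal_preimage:
  assumes \<sigma>: "\<sigma> \<in> gal F" and E: "subfield E"
  shows "subfield {x \<in> Q. \<sigma> x \<in> E}"
  using subfieldD[OF E] subfieldD[OF Q] galD[OF \<sigma>] gal_minus[OF \<sigma>] gal_inverse[OF \<sigma>] subfieldD(2)[OF F]
  by (intro subfieldI) auto

text \<open>Both inclusions use the minimality of \<open>Q\<close>: the preimage of \<open>Q\<close>
  and the image of \<open>Q\<close> are subfields over \<open>F\<close> closed under square
  roots.\<close>

lemma gal_image:
  assumes \<sigma>: "\<sigma> \<in> gal F"
  shows "\<sigma> ` Q = Q"
proof
  have "Q \<subseteq> {x \<in> Q. \<sigma> x \<in> Q}"
  proof (rule Q_least[OF subfield_gal_preimage[OF \<sigma> Q]])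
    show "F \<subseteq> {x \<in> Q. \<sigma> x \<in> Q}" using F_subset_Q galD(3)[OF \<sigma>] by auto
    show "z \<in> {x \<in> Q. \<sigma> x \<in> Q}" if "z * z \<in> {x \<in> Q. \<sigma> x \<in> Q}" for z
      using that Q_sqrt[of z] Q_sqrt[of "\<sigma> z"] galD(2)[OF \<sigma>, of z z] by auto
  qed
  then show "\<sigma> ` Q \<subseteq> Q" by blast
  show "Q \<subseteq> \<sigma> ` Q"
  proof (rule Q_least)
    show "subfield (\<sigma> ` Q)"
    proof (rule subfieldI)
      show "1 \<in> \<sigma> ` Q" using galD(3)[OF \<sigma>, of 1] subfieldD(2)[OF F] subfieldD(2)[OF Q] by force
    next
      fix x y assume "x \<in> \<sigma> ` Q" "y \<in> \<sigma> ` Q"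
      then obtain u v where "u \<in> Q" "v \<in> Q" "x = \<sigma> u" "y = \<sigma> v" by blast
      then show "x + y \<in> \<sigma> ` Q" "x * y \<in> \<sigma> ` Q"
        using galD(1,2)[OF \<sigma>, of u v] subfieldD(3,4)[OF Q, of u v] by force+
    next
      fix x assume "x \<in> \<sigma> ` Q"
      then obtain u where "u \<in> Q" "x = \<sigma> u" by blast
      then show "- x \<in> \<sigma> ` Q" "inverse x \<in> \<sigma> ` Q"
        using gal_minus[OF \<sigma>, of u] gal_inverse[OF \<sigma>, of u] subfieldD(5,6)[OF Q, of u] by force+
    qed
    show "F \<subseteq> \<sigma> ` Q" using galD(3)[OF \<sigma>] F_subset_Q by force
  next
    fix z assume "z * z \<in> \<sigma> ` Q"
    then obtain w where w: "w \<in> Q" "z * z = \<sigma> w" by blast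
    obtain v where v: "v * v = w" using sqrt_exists by blast
    then have "v \<in> Q" using w Q_sqrt by blast
    then have "z * z = \<sigma> v * \<sigma> v" using galD(2)[OF \<sigma>, of v v] v w by simp
    then have "z = \<sigma> v \<or> z = \<sigma> (- v)"
      using gal_minus[OF \<sigma> \<open>v \<in> Q\<close>] by (simp add: square_eq_iff)
    then show "z \<in> \<sigma> ` Q" using \<open>v \<in> Q\<close> subfieldD(5)[OF Q] by blast
  qed
qed

lemma gal_mem_Q: "\<sigma> \<in> gal F \<Longrightarrow> x \<in> Q \<Longrightarrow> \<sigma> x \<in> Q"
  using gal_image by blast

lemma gal_comp:
  assumes "F \<subseteq> K" "\<sigma> \<in> gal K" "\<tau> \<in> gal K"
  shows "\<sigma> \<circ> \<tau> \<in> gal K"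
proof -
  have "\<tau> \<in> gal F" using assms gal_antimono by blast
  then show ?thesis using assms gal_mem_Q[of \<tau>] by (auto simp: gal_def)
qed

lemma gal_inv:
  assumes K: "F \<subseteq> K" "K \<subseteq> Q" and \<sigma>: "\<sigma> \<in> gal K"
  obtains \<tau> where "\<tau> \<in> gal K" "\<And>x. x \<in> Q \<Longrightarrow> \<sigma> (\<tau> x) = x" "\<And>x. x \<in> Q \<Longrightarrow> \<tau> (\<sigma> x) = x"
proof -
  have \<sigma>F: "\<sigma> \<in> gal F" using \<sigma> gal_antimono K by blast
  define \<tau> where "\<tau> = inv_into Q \<sigma>"
  have t: "\<tau> x \<in> Q" "\<sigma> (\<tau> x) = x" if "x \<in> Q" for x
    using that gal_image[OF \<sigma>F] by (auto simp: \<tau>_def f_inv_into_f inv_into_into)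
  have t': "\<tau> (\<sigma> x) = x" if "x \<in> Q" for x
    using that gal_inj[OF \<sigma>F] by (simp add: \<tau>_def)
  have "\<tau> \<in> gal K"
    unfolding gal_def
  proof (intro CollectI conjI ballI)
    fix x y assume xy: "x \<in> Q" "y \<in> Q"
    have "\<sigma> (\<tau> x + \<tau> y) = x + y" "\<sigma> (\<tau> x * \<tau> y) = x * y"
      using galD(1,2)[OF \<sigma>F, of "\<tau> x" "\<tau> y"] t xy by auto
    then show "\<tau> (x + y) = \<tau> x + \<tau> y" "\<tau> (x * y) = \<tau> x * \<tau> y"
      using t'[of "\<tau> x + \<tau> y"] t'[of "\<tau> x * \<tau> y"] t xy subfieldD(3,4)[OF Q] by auto
  next
    fix x assume "x \<in> K"
    then show "\<tau> x = x" using t'[of x] \<sigma> K by (auto simp: gal_def)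
  qed
  then show ?thesis using that t(2) t' by blast
qed

text \<open>A maximal subfield avoiding \<open>x\<close> has a quadratic extension containing \<open>x\<close>,
  and its nontrivial automorphism moves \<open>x\<close>.\<close>

lemma gal_fixed_field:
  assumes x: "x \<in> Q" and fixed: "\<And>\<sigma>. \<sigma> \<in> gal F \<Longrightarrow> \<sigma> x = x"
  shows "x \<in> F"
proof (rule ccontr)
  assume "x \<notin> F"
  define \<A> where "\<A> = {K. subfield K \<and> F \<subseteq> K \<and> K \<subseteq> Q \<and> x \<notin> K}"
  have "\<exists>K\<in>\<A>. \<forall>X\<in>\<A>. K \<subseteq> X \<longrightarrow> X = K"
  proof (rule subset_Zorn_nonempty)
    show "\<A> \<noteq> {}" using F F_subset_Q \<open>x \<notin> F\<close> by (auto simp: \<A>_def)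
  next
    fix \<C> assume ne: "\<C> \<noteq> {}" and ch: "subset.chain \<A> \<C>"
    have mem: "subfield X" "F \<subseteq> X" "X \<subseteq> Q" "x \<notin> X" if "X \<in> \<C>" for X
      using ch that by (auto simp: subset.chain_def \<A>_def)
    have common: "\<exists>X\<in>\<C>. p \<in> X \<and> q \<in> X" if "p \<in> \<Union>\<C>" "q \<in> \<Union>\<C>" for p q
      using that by (rule chain_Union_common[OF ch])
    have "subfield (\<Union>\<C>)"
    proof (rule subfieldI)
      show "1 \<in> \<Union>\<C>" using ne subfieldD(2)[OF mem(1)] by blast
    next
      fix x y assume "x \<in> \<Union>\<C>" "y \<in> \<Union>\<C>"
      then obtain X where "X \<in> \<C>" "x \<in> X" "y \<in> X" using common by blast
      then show "x + y \<in> \<Union>\<C>" "x * y \<in> \<Union>\<C>" using subfieldD(3,4)[OF mem(1)] by blast+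
    next
      fix x assume "x \<in> \<Union>\<C>"
      then show "- x \<in> \<Union>\<C>" "inverse x \<in> \<Union>\<C>" using subfieldD(5,6)[OF mem(1)] by blast+
    qed
    then show "\<Union>\<C> \<in> \<A>" using ne mem(2-4) by (auto simp: \<A>_def)
  qed
  then obtain K where K: "subfield K" "F \<subseteq> K" "K \<subseteq> Q" "x \<notin> K"
    and max: "\<And>X. X \<in> \<A> \<Longrightarrow> K \<subseteq> X \<Longrightarrow> X = K"
    by (auto simp: \<A>_def)
  have "\<not> Q \<subseteq> K" using x K(4) by blast
  then obtain z where z: "z * z \<in> K" "z \<notin> K" using Q_least[OF K(1,2)] by blast
  have "adjoin K {z} \<subseteq> Q" using adjoin_subset_Q z K(3) by blast
  \<comment> \<open>A field strictly between \<open>K\<close> and \<open>Q\<close>, or equal to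
    \<open>Q\<close>, contains \<open>x\<close> by maximality of \<open>K\<close>.\<close>
  then have "x \<in> adjoin K {z}"
    using max[of "adjoin K {z}"] adjoin_superset[of K "{z}"] adjoin_generator[of z K] z K(2)
      subfield_adjoin[of K "{z}"]
    unfolding \<A>_def by (metis (mono_tags, lifting) mem_Collect_eq order_trans)
  then obtain u v where uv: "u \<in> K" "v \<in> K" "x = u + v * z"
    using adjoin_square_root[OF K(1) z(1)] by blast
  have id: "hom_graph (Id_on K)"
    using subfieldD[OF K(1)] by (auto simp: hom_graph_def)
  have dom: "fst ` Id_on K = K" by force
  \<comment> \<open>\<open>- z\<close> is the other root of \<open>z * z\<close>, so the identity of
    \<open>K\<close> extends to \<open>K(z)\<close> as the conjugation.\<close>
  have "(z * z, (- z) * (- z)) \<in> Id_on K" using z by auto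
  note ext = hom_graph_adjoin_square_root[OF id this, unfolded dom, OF z(2)]
  obtain \<sigma> where \<sigma>: "\<sigma> \<in> gal F" and \<sigma>': "\<And>y y'. y \<in> K \<Longrightarrow> \<sigma> y = y" "\<sigma> z = - z"
  proof (rule hom_graph_extends[OF ext(1)])
    show "fst ` {(u + v * z, u' + v' * - z) |u u' v v'. (u, u') \<in> Id_on K \<and> (v, v') \<in> Id_on K} \<subseteq> Q"
      using ext(4) \<open>adjoin K {z} \<subseteq> Q\<close> by blast
    show "Id_on F \<subseteq> {(u + v * z, u' + v' * - z) |u u' v v'. (u, u') \<in> Id_on K \<and> (v, v') \<in> Id_on K}"
      using Id_on_mono[OF K(2)] ext(2) by (rule order_trans)
  next
    fix \<sigma> assume "\<sigma> \<in> gal F" and s: "\<And>x x'. (x, x') \<in> {(u + v * z, u' + v' * - z) |u u' v v'.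
      (u, u') \<in> Id_on K \<and> (v, v') \<in> Id_on K} \<Longrightarrow> \<sigma> x = x'"
    have "\<sigma> y = y" if "y \<in> K" for y
      using s[of y y] ext(2) that by blast
    then show thesis using that \<open>\<sigma> \<in> gal F\<close> s[OF ext(3)] by blast
  qed
  have zQ: "z \<in> Q" using z(1) K(3) Q_sqrt by blast
  have uvQ: "u \<in> Q" "v \<in> Q" using uv K(3) by auto
  have "\<sigma> x = \<sigma> u + \<sigma> v * \<sigma> z"
    using uv(3) galD(1)[OF \<sigma> uvQ(1) subfieldD(4)[OF Q uvQ(2) zQ]] galD(2)[OF \<sigma> uvQ(2) zQ] by simp
  then have "u + v * z = u - v * z" using fixed[OF \<sigma>] \<sigma>' uv by simp
  then have "2 * (v * z) = 0" by (simp add: eq_diff_eq)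
  then have "v = 0 \<or> z = 0" using two by simp
  then show False using uv K(4) z(2) subfieldD(1)[OF K(1)] by auto
qed

text \<open>Elements with finite orbit form a subfield, and it is closed under square roots because
  each conjugate of \<open>z\<close> is one of the two roots of a conjugate of
  \<open>z * z\<close>.\<close>

lemma finite_orbit:
  assumes "x \<in> Q"
  shows "finite ((\<lambda>\<sigma>. \<sigma> x) ` gal F)"
proof -
  let ?O = "\<lambda>x. (\<lambda>\<sigma>. \<sigma> x) ` gal F"
  let ?K = "{x \<in> Q. finite (?O x)}"
  have "Q \<subseteq> ?K"
  proof (rule Q_least)
    show "subfield ?K"
    proof (rule subfieldI)
      have "?O 1 \<subseteq> {1}" using subfieldD(2)[OF F] by (auto simp: gal_def)
      then show "1 \<in> ?K" using subfieldD(2)[OF Q] finite_subset by auto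
    next
      fix x y assume "x \<in> ?K" "y \<in> ?K"
      then have xy: "x \<in> Q" "y \<in> Q" "finite (?O x \<times> ?O y)" by auto
      have "?O (x + y) \<subseteq> (\<lambda>(a, b). a + b) ` (?O x \<times> ?O y)"
        by (auto simp: galD(1) xy intro!: image_eqI[where x = "(_, _)"])
      moreover have "?O (x * y) \<subseteq> (\<lambda>(a, b). a * b) ` (?O x \<times> ?O y)"
        by (auto simp: galD(2) xy intro!: image_eqI[where x = "(_, _)"])
      ultimately have "finite (?O (x + y))" "finite (?O (x * y))"
        using finite_subset[OF _ finite_imageI[OF xy(3)]] by blast+
      then show "x + y \<in> ?K" "x * y \<in> ?K"
        using xy subfieldD(3,4)[OF Q] by auto
    next
      fix x assume "x \<in> ?K"
      then have x: "x \<in> Q" "finite (?O x)" by auto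
      have "?O (- x) \<subseteq> uminus ` ?O x" "?O (inverse x) \<subseteq> inverse ` ?O x"
        by (auto simp: gal_minus gal_inverse x)
      then have "finite (?O (- x))" "finite (?O (inverse x))"
        using finite_subset[OF _ finite_imageI[OF x(2)]] by blast+
      then show "- x \<in> ?K" "inverse x \<in> ?K"
        using x subfieldD(5,6)[OF Q] by auto
    qed
    have "?O x \<subseteq> {x}" if "x \<in> F" for x using that by (auto simp: gal_def)
    then have "finite (?O x)" if "x \<in> F" for x using finite_subset that by blast
    then show "F \<subseteq> ?K" using F_subset_Q by auto
  next
    fix z assume z: "z * z \<in> ?K"
    then have zQ: "z \<in> Q" using Q_sqrt[of z] by auto
    define r where "r y = (SOME w. w * w = y)" for y :: 'a
    have r: "r y * r y = y" for y unfolding r_def by (rule someI_ex) (rule sqrt_exists)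
    have "?O z \<subseteq> r ` ?O (z * z) \<union> (\<lambda>y. - r y) ` ?O (z * z)"
    proof
      fix w assume "w \<in> ?O z"
      then obtain \<sigma> where \<sigma>: "\<sigma> \<in> gal F" "w = \<sigma> z" by blast
      then have "w * w = \<sigma> (z * z)" using galD(2)[OF \<sigma>(1) zQ zQ] by simp
      then have "w * w = r (\<sigma> (z * z)) * r (\<sigma> (z * z))" using r by simp
      then have "w = r (\<sigma> (z * z)) \<or> w = - r (\<sigma> (z * z))" by (simp add: square_eq_iff)
      then show "w \<in> r ` ?O (z * z) \<union> (\<lambda>y. - r y) ` ?O (z * z)" using \<sigma>(1) by blast
    qed
    moreover have "finite (r ` ?O (z * z) \<union> (\<lambda>y. - r y) ` ?O (z * z))" using z by simp
    ultimately have "finite (?O z)" by (rule finite_subset)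
    then show "z \<in> ?K" using zQ by simp
  qed
  then show ?thesis using assms by blast
qed

section \<open>Stability under automorphisms and Galois extensions\<close>

definition stable :: "'a set \<Rightarrow> 'a set \<Rightarrow> bool" where
  "stable K E \<longleftrightarrow> (\<forall>\<sigma>\<in>gal K. \<forall>x\<in>E. \<sigma> x \<in> E)"

lemma stableD: "stable K E \<Longrightarrow> \<sigma> \<in> gal K \<Longrightarrow> x \<in> E \<Longrightarrow> \<sigma> x \<in> E"
  by (auto simp: stable_def)

text \<open>Images of generators may land anywhere in the generated field; this covers a root
  \<open>z\<close> whose conjugate is \<open>z\<close> times an element of the base.\<close>

lemma stable_field_gen:
  assumes K: "F \<subseteq> K" and S: "S \<subseteq> Q" "\<And>\<sigma> x. \<sigma> \<in> gal K \<Longrightarrow> x \<in> S \<Longrightarrow> \<sigma> x \<in> field_gen S"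
  shows "stable K (field_gen S)"
  unfolding stable_def
proof (intro ballI)
  fix \<sigma> x assume \<sigma>: "\<sigma> \<in> gal K" and x: "x \<in> field_gen S"
  have "\<sigma> \<in> gal F" using \<sigma> gal_antimono[OF K] by blast
  moreover have "S \<subseteq> {x \<in> Q. \<sigma> x \<in> field_gen S}" using S(1) S(2)[OF \<sigma>] by auto
  ultimately have "field_gen S \<subseteq> {x \<in> Q. \<sigma> x \<in> field_gen S}"
    by (intro field_gen_least subfield_gal_preimage) auto
  then show "\<sigma> x \<in> field_gen S" using x by blast
qed

text \<open>Acting on the coefficients amounts to acting on the roots. Membership in
  \<open>Q\<close> is carried through the induction because \<open>\<sigma>\<close> respects the
  operations only there.\<close>

lemma coeff_prod_linear_gal:
  assumes \<sigma>: "\<sigma> \<in> gal F" and S: "finite S" "S \<subseteq> Q"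
  shows "coeff (\<Prod>s\<in>S. [:- s, 1:]) i \<in> Q \<and>
    \<sigma> (coeff (\<Prod>s\<in>S. [:- s, 1:]) i) = coeff (\<Prod>s\<in>S. [:- \<sigma> s, 1:]) i"
  using S
proof (induction S arbitrary: i rule: finite_induct)
  case empty
  then show ?case
    using subfieldD(1,2)[OF Q] subfieldD(1,2)[OF F] galD(3)[OF \<sigma>] by (auto simp: coeff_1 split: if_splits)
next
  case (insert s S)
  have c: "coeff ([:- t, 1:] * p) i = - (t * coeff p i) + (if i = 0 then 0 else coeff p (i - 1))"
    for t :: 'a and p i
    by (cases i) auto
  define p q where "p = (\<Prod>s\<in>S. [:- s, 1:])" and "q = (\<Prod>s\<in>S. [:- \<sigma> s, 1:])"
  have s: "s \<in> Q" and IH: "coeff p i \<in> Q" "\<sigma> (coeff p i) = coeff q i" for i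
    using insert.IH insert.prems by (auto simp: p_def q_def)
  define e where "e = (if i = 0 then 0 else coeff p (i - 1))"
  have e: "e \<in> Q" "\<sigma> e = (if i = 0 then 0 else coeff q (i - 1))"
    using IH subfieldD(1)[OF Q] subfieldD(1)[OF F] galD(3)[OF \<sigma>] by (auto simp: e_def)
  have sp: "s * coeff p i \<in> Q" "- (s * coeff p i) \<in> Q" using s IH subfieldD[OF Q] by auto
  have "coeff ([:- s, 1:] * p) i \<in> Q \<and> \<sigma> (coeff ([:- s, 1:] * p) i) = coeff ([:- \<sigma> s, 1:] * q) i"
    unfolding c unfolding e_def[symmetric] e(2)[symmetric] IH(2)[of i, symmetric]
    using galD(1)[OF \<sigma> sp(2) e(1)] gal_minus[OF \<sigma> sp(1)] galD(2)[OF \<sigma> s IH(1)]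
      subfieldD(3)[OF Q sp(2) e(1)] by simp
  then show ?case using insert.hyps by (simp add: p_def q_def)
qed

text \<open>The product of \<open>X - s\<close> over the orbit of \<open>x\<close> witnesses
  algebraicity, normality and separability at once: its coefficients are fixed by
  \<open>gal F\<close>, hence lie in \<open>F\<close>, and its roots are distinct and lie in
  \<open>E\<close>.\<close>

lemma galois_ext_if_stable:
  assumes E: "subfield E" "F \<subseteq> E" "E \<subseteq> Q" and st: "stable F E"
  shows "galois_ext F E"
proof -
  have main: "\<exists>p. p \<noteq> 0 \<and> poly_over F p \<and> poly p x = 0 \<and> {y. poly p y = 0} \<subseteq> E \<and> rsquarefree p"
    if x: "x \<in> E" for x
  proof -
    define R where "R = (\<lambda>\<sigma>. \<sigma> x) ` gal F"
    define p where "p = (\<Prod>s\<in>R. [:- s, 1:])"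
    have fin: "finite R" unfolding R_def using finite_orbit x E(3) by blast
    have RE: "R \<subseteq> E" using st x by (auto simp: R_def stable_def)
    have p0: "p \<noteq> 0" unfolding p_def using fin by (auto simp: prod_zero_iff)
    have "id \<in> gal F" by (auto simp: gal_def)
    then have "x \<in> R" unfolding R_def using imageI[of id "gal F" "\<lambda>\<sigma>. \<sigma> x"] by simp
    have roots: "poly p y = 0 \<longleftrightarrow> y \<in> R" for y
      unfolding p_def using fin by (auto simp: poly_prod prod_zero_iff)
    have "coeff p i \<in> F" for i
    proof (rule gal_fixed_field)
      have RQ: "R \<subseteq> Q" using RE E(3) by blast
      show "coeff p i \<in> Q"
        using coeff_prod_linear_gal[OF \<open>id \<in> gal F\<close> fin RQ] by (simp add: p_def)
      fix \<sigma> assume \<sigma>: "\<sigma> \<in> gal F"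
      have inj: "inj_on \<sigma> R" using gal_inj[OF \<sigma>] RQ inj_on_subset by blast
      have "\<sigma> ` R \<subseteq> R"
      proof
        fix y assume "y \<in> \<sigma> ` R"
        then obtain \<tau> where "\<tau> \<in> gal F" "y = (\<sigma> \<circ> \<tau>) x" by (auto simp: R_def)
        then show "y \<in> R" unfolding R_def using gal_comp[OF _ \<sigma>, of \<tau>] by blast
      qed
      \<comment> \<open>An injective self-map of a finite set is onto, so \<open>\<sigma>\<close>
        permutes the roots.\<close>
      then have im: "\<sigma> ` R = R" using fin inj by (simp add: endo_inj_surj)
      have "(\<Prod>s\<in>R. [:- \<sigma> s, 1:]) = (\<Prod>s\<in>\<sigma> ` R. [:- s, 1:])"
        using inj by (simp add: prod.reindex)
      then show "\<sigma> (coeff p i) = coeff p i"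
        using coeff_prod_linear_gal[OF \<sigma> fin RQ] im by (simp add: p_def)
    qed
    moreover have "rsquarefree p"
      unfolding rsquarefree_def
    proof (intro conjI allI p0)
      fix a
      \<comment> \<open>Orders add over the factors, and at most one of the distinct linear factors
        vanishes at \<open>a\<close>.\<close>
      have "order a p = (\<Sum>s\<in>R. order a [:- s, 1:])"
        unfolding p_def using fin
      proof (induction R rule: finite_induct)
        case empty
        then show ?case by (simp add: order_0I)
      next
        case (insert s R)
        then have "(\<Prod>s\<in>insert s R. [:- s, 1:]) \<noteq> 0"
          by (simp add: prod_zero_iff del: prod.insert)
        then show ?case using insert by (simp add: order_mult del: mult_pCons_left)
      qed
      also have "\<dots> = (\<Sum>s\<in>R. if s = a then 1 else 0)"
      proof (rule sum.cong[OF refl])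
        fix s
        show "order a [:- s, 1:] = (if s = a then 1 else 0)"
          using order_power_n_n[of a 1] by (auto intro: order_0I)
      qed
      also have "\<dots> = (if a \<in> R then 1 else 0)" using fin by simp
      finally show "order a p = 0 \<or> order a p = 1" by simp
    qed
    ultimately show ?thesis
      using p0 roots RE \<open>x \<in> R\<close> unfolding poly_over_def by (intro exI[of _ p]) auto
  qed
  show ?thesis
    unfolding galois_ext_def algebraic_ext_def normal_ext_def separable_ext_def
    using E F main by meson
qed

text \<open>An automorphism fixing the coefficients of a polynomial over \<open>K\<close> sends
  roots to roots, and normality keeps all roots in \<open>E\<close>.\<close>

lemma stable_if_galois_ext:
  assumes K: "F \<subseteq> K" "K \<subseteq> Q" and E: "E \<subseteq> Q" and gal: "galois_ext K E"
  shows "stable K E"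
  unfolding stable_def
proof (intro ballI)
  fix \<sigma> x assume \<sigma>: "\<sigma> \<in> gal K" and x: "x \<in> E"
  have \<sigma>F: "\<sigma> \<in> gal F" using \<sigma> gal_antimono[OF K(1)] by blast
  obtain p where p: "poly_over K p" "poly p x = 0" "{y. poly p y = 0} \<subseteq> E"
    using gal x by (auto simp: galois_ext_def normal_ext_def)
  have xQ: "x \<in> Q" using x E by blast
  have "poly p x \<in> Q \<and> \<sigma> (poly p x) = poly p (\<sigma> x)"
    using p(1)
  proof (induction p)
    case 0
    then show ?case using subfieldD(1)[OF Q] subfieldD(1)[OF F] galD(3)[OF \<sigma>F] by simp
  next
    case (pCons a p)
    have a: "a \<in> K" using pCons.prems by (auto simp: poly_over_def dest: spec[of _ 0])
    have "poly_over K p"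
      unfolding poly_over_def using pCons.prems by (metis coeff_pCons_Suc poly_over_def)
    then have IH: "poly p x \<in> Q" "\<sigma> (poly p x) = poly p (\<sigma> x)" using pCons.IH by auto
    have aQ: "a \<in> Q" "\<sigma> a = a" using a K \<sigma> by (auto simp: gal_def)
    have m: "x * poly p x \<in> Q" using subfieldD(4)[OF Q xQ IH(1)] .
    show ?case
      using subfieldD(3)[OF Q aQ(1) m] galD(1)[OF \<sigma>F aQ(1) m] galD(2)[OF \<sigma>F xQ IH(1)] IH aQ by simp
  qed
  then have "poly p (\<sigma> x) = 0"
    using p(2) galD(3)[OF \<sigma>F] subfieldD(1)[OF F] by simp
  then show "\<sigma> x \<in> E" using p(3) by blast
qed

end

section \<open>Towers of square roots\<close>

text \<open>A step may be trivial, with \<open>z\<close> already in \<open>E\<close>; thus towers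
  survive composita without case distinctions.\<close>

inductive sqrt_tower :: "'a::field set \<Rightarrow> 'a set \<Rightarrow> bool" for F where
  base: "sqrt_tower F F"
| step: "sqrt_tower F E \<Longrightarrow> z * z \<in> E \<Longrightarrow> sqrt_tower F (adjoin E {z})"

lemma sqrt_tower_subfield:
  assumes "sqrt_tower F E" "subfield F"
  shows "subfield E" "F \<subseteq> E"
  using assms by (induction) (auto intro: subsetD[OF adjoin_superset])

lemma sqrt_tower_basis:
  assumes "sqrt_tower F E" "subfield F"
  shows "\<exists>B k. basis_over F E B \<and> card B = 2 ^ k"
  using assms(1)
proof induction
  case base
  have "basis_over F F {1}" "card {1::'a} = 2 ^ 0" using basis_over_one[OF assms(2)] by auto
  then show ?case by blast
next
  case (step E z)
  note E = sqrt_tower_subfield[OF step.hyps(1) assms(2)]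
  obtain B k where B: "basis_over F E B" "card B = 2 ^ k" using step.IH by blast
  show ?case
  proof (cases "z \<in> E")
    case True
    then show ?thesis using adjoin_trivial[OF E(1)] B by auto
  next
    case False
    note b = basis_over_adjoin_square_root[OF assms(2) E B(1) step.hyps(2) False]
    have "card (B \<union> (\<lambda>b. b * z) ` B) = 2 ^ Suc k" using b(2) B(2) by simp
    then show ?thesis using b(1) by blast
  qed
qed

text \<open>The roots that build \<open>E\<close> are adjoined on top of \<open>E'\<close> instead;
  their squares still lie in the field reached before.\<close>

lemma sqrt_tower_compositum:
  assumes "sqrt_tower F E'" "sqrt_tower F E" "subfield F"
  shows "sqrt_tower F (field_gen (E' \<union> E))"
  using assms(2)
proof induction
  case base
  have "E' \<union> F = E'" using sqrt_tower_subfield[OF assms(1,3)] by blast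
  then show ?case using assms(1) sqrt_tower_subfield[OF assms(1,3)] by (simp add: field_gen_subfield)
next
  case (step E z)
  have "field_gen (E' \<union> adjoin E {z}) = adjoin (field_gen (E' \<union> E)) {z}"
  proof
    have E: "E' \<union> E \<subseteq> adjoin (field_gen (E' \<union> E)) {z}"
      using field_gen_superset adjoin_superset by (rule order_trans)
    then have "adjoin E {z} \<subseteq> adjoin (field_gen (E' \<union> E)) {z}"
      by (intro adjoin_least) auto
    then show "field_gen (E' \<union> adjoin E {z}) \<subseteq> adjoin (field_gen (E' \<union> E)) {z}"
      using E by (intro field_gen_least) auto
    have "field_gen (E' \<union> E) \<subseteq> field_gen (E' \<union> adjoin E {z})"
      using adjoin_superset[of E "{z}"] by (intro field_gen_mono) auto
    moreover have "z \<in> field_gen (E' \<union> adjoin E {z})"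
      using field_gen_superset[of "E' \<union> adjoin E {z}"] adjoin_generator[of z E] by blast
    ultimately show "adjoin (field_gen (E' \<union> E)) {z} \<subseteq> field_gen (E' \<union> adjoin E {z})"
      by (intro adjoin_least) auto
  qed
  moreover have "z * z \<in> field_gen (E' \<union> E)"
    using step.hyps(2) field_gen_superset[of "E' \<union> E"] by blast
  ultimately show ?case using sqrt_tower.step[OF step.IH] by simp
qed

lemma sqrt_tower_adjoin_finite:
  assumes "finite S" "\<And>z. z \<in> S \<Longrightarrow> z * z \<in> E" "sqrt_tower F E" "subfield F"
  shows "sqrt_tower F (adjoin E S)"
  using assms(1,2)
proof (induction rule: finite_induct)
  case empty
  then show ?case
    using assms(3) sqrt_tower_subfield[OF assms(3,4)] by (simp add: adjoin_def field_gen_subfield)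
next
  case (insert z S)
  have "adjoin E (insert z S) = adjoin (adjoin E S) {z}"
  proof
    have "E \<union> S \<subseteq> adjoin E S" unfolding adjoin_def by (rule field_gen_superset)
    also have "\<dots> \<subseteq> adjoin (adjoin E S) {z}" by (rule adjoin_superset)
    finally show "adjoin E (insert z S) \<subseteq> adjoin (adjoin E S) {z}"
      by (intro adjoin_least) auto
    have "E \<union> insert z S \<subseteq> adjoin E (insert z S)" unfolding adjoin_def by (rule field_gen_superset)
    then show "adjoin (adjoin E S) {z} \<subseteq> adjoin E (insert z S)"
      by (intro adjoin_least) auto
  qed
  moreover have "z * z \<in> adjoin E S" using insert.prems[of z] adjoin_superset[of E S] by blast
  ultimately show ?case using sqrt_tower.step[OF insert.IH] insert.prems by simp
qed

section \<open>Exhausting the square root closure by finite stable towers\<close>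

context quadratic_base
begin

text \<open>Composita make the union of all stable towers a subfield. To reach a root
  \<open>z\<close> and stay stable, all its conjugates are adjoined together: they are finitely
  many, and their squares are conjugates of \<open>z * z\<close>, hence in \<open>E\<close>.\<close>

lemma Q_stable_tower:
  assumes "x \<in> Q"
  shows "\<exists>E. sqrt_tower F E \<and> E \<subseteq> Q \<and> stable F E \<and> x \<in> E"
proof -
  let ?T = "\<lambda>E. sqrt_tower F E \<and> E \<subseteq> Q \<and> stable F E"
  let ?P = "\<Union>{E. ?T E}"
  have TF: "?T F" using F_subset_Q by (auto simp: stable_def gal_def sqrt_tower.base)
  have comp: "\<exists>E''. ?T E'' \<and> E \<subseteq> E'' \<and> E' \<subseteq> E''" if "?T E" "?T E'" for E E'
  proof (intro exI conjI)
    show "sqrt_tower F (field_gen (E \<union> E'))" using that F by (simp add: sqrt_tower_compositum)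
    show "field_gen (E \<union> E') \<subseteq> Q" using that by (intro field_gen_least[OF Q]) auto
    show "E \<subseteq> field_gen (E \<union> E')" "E' \<subseteq> field_gen (E \<union> E')"
      using field_gen_superset[of "E \<union> E'"] by auto
    then show "stable F (field_gen (E \<union> E'))"
      using that by (intro stable_field_gen) (auto dest: stableD)
  qed
  have sf: "subfield E" if "?T E" for E using that sqrt_tower_subfield F by blast
  have "Q \<subseteq> ?P"
  proof (rule Q_least)
    show "subfield ?P"
    proof (rule subfieldI)
      show "1 \<in> ?P" using TF subfieldD(2)[OF F] by blast
    next
      fix x y assume "x \<in> ?P" "y \<in> ?P"
      then obtain E E' where E: "?T E" "?T E'" "x \<in> E" "y \<in> E'" by blast
      then obtain E'' where E'': "?T E''" "x \<in> E''" "y \<in> E''" using comp[OF E(1,2)] by blast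
      then have "x + y \<in> E''" "x * y \<in> E''" using subfieldD(3,4)[OF sf] by auto
      then show "x + y \<in> ?P" "x * y \<in> ?P" using E''(1) by blast+
    next
      fix x assume "x \<in> ?P"
      then obtain E where E: "?T E" "x \<in> E" by blast
      then have "- x \<in> E" "inverse x \<in> E" using subfieldD(5,6)[OF sf] by auto
      then show "- x \<in> ?P" "inverse x \<in> ?P" using E(1) by blast+
    qed
    show "F \<subseteq> ?P" using TF by blast
  next
    fix z assume "z * z \<in> ?P"
    then obtain E where E: "?T E" "z * z \<in> E" by blast
    then have zQ: "z \<in> Q" using Q_sqrt[of z] by blast
    define R where "R = (\<lambda>\<sigma>. \<sigma> z) ` gal F"
    have R2: "w * w \<in> E" if w: "w \<in> R" for w
    proof -
      obtain \<sigma> where \<sigma>: "\<sigma> \<in> gal F" "w = \<sigma> z" using w by (auto simp: R_def)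
      then have "w * w = \<sigma> (z * z)" using galD(2)[OF \<sigma>(1) zQ zQ] by simp
      then show ?thesis using E \<sigma>(1) stableD by metis
    qed
    have RQ: "R \<subseteq> Q" using gal_mem_Q zQ by (auto simp: R_def)
    have ER: "E \<union> R \<subseteq> adjoin E R" unfolding adjoin_def by (rule field_gen_superset)
    have "sqrt_tower F (adjoin E R)"
      using E F finite_orbit[OF zQ] R2 by (intro sqrt_tower_adjoin_finite) (auto simp: R_def)
    moreover have "adjoin E R \<subseteq> Q" using E RQ by (intro adjoin_least[OF Q]) auto
    moreover have "stable F (adjoin E R)"
      unfolding adjoin_def
    proof (rule stable_field_gen)
      show "E \<union> R \<subseteq> Q" using E RQ by blast
      fix \<sigma> x assume \<sigma>: "\<sigma> \<in> gal F" and "x \<in> E \<union> R"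
      then consider "x \<in> E" | \<tau> where "\<tau> \<in> gal F" "x = \<tau> z" by (auto simp: R_def)
      then have "\<sigma> x \<in> E \<union> R"
      proof cases
        case 1
        then show ?thesis using E \<sigma> stableD by blast
      next
        case 2
        have "\<sigma> x = (\<sigma> \<circ> \<tau>) z" using 2 by simp
        then show ?thesis unfolding R_def using gal_comp[OF _ \<sigma> 2(1)] by blast
      qed
      then show "\<sigma> x \<in> field_gen (E \<union> R)" by (rule subsetD[OF field_gen_superset])
    qed simp
    moreover have "z \<in> adjoin E R"
    proof -
      have "id \<in> gal F" by (auto simp: gal_def)
      then have "z \<in> R" unfolding R_def using imageI[of id "gal F" "\<lambda>\<sigma>. \<sigma> z"] by simp
      then show ?thesis using ER by blast
    qed
    ultimately show "z \<in> ?P" by blast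
  qed
  then show ?thesis using assms by blast
qed

text \<open>A stable tower is Galois over \<open>F\<close> of degree a power of 2, so it is among
  the generators of \<open>quad_closure F\<close>. This supplies the containment required in
  \<open>qstep\<close> and \<open>galois_closure\<close>.\<close>

lemma Q_subset_quad_closure: "Q \<subseteq> quad_closure F"
proof
  fix x assume "x \<in> Q"
  then obtain E where E: "sqrt_tower F E" "E \<subseteq> Q" "stable F E" "x \<in> E"
    using Q_stable_tower by blast
  note sf = sqrt_tower_subfield[OF E(1) F]
  obtain B k where B: "basis_over F E B" "card B = 2 ^ k" using sqrt_tower_basis[OF E(1) F] by blast
  have "galois_ext F E" by (rule galois_ext_if_stable[OF sf E(2,3)])
  moreover have "finite_ext F E" "ext_degree F E = 2 ^ k" using ext_degree_basis[OF F B(1)] B(2) by auto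
  ultimately show "x \<in> quad_closure F"
    unfolding quad_closure_def using E(4) by (intro subsetD[OF field_gen_superset]) blast
qed

section \<open>The filtration\<close>

lemma qstep_superset: "M \<subseteq> qstep F K M"
  unfolding qstep_def using field_gen_superset by blast

text \<open>Each quadratic extension of \<open>M\<close> is generated by a square root, hence stays
  in \<open>Q\<close>; being Galois over \<open>K\<close>, it is stable.\<close>

lemma qstep_properties:
  assumes K: "F \<subseteq> K" "K \<subseteq> Q" and M: "M \<subseteq> Q" "stable K M"
  shows "qstep F K M \<subseteq> Q" "stable K (qstep F K M)"
proof -
  have E: "E \<subseteq> Q" "stable K E" if E: "quad_ext M E" "galois_ext K E" for E
  proof -
    obtain z where "z * z \<in> M" "E = adjoin M {z}"
      using quad_ext_imp_square_root[OF E(1) two] by blast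
    then show "E \<subseteq> Q" using adjoin_subset_Q M(1) by blast
    then show "stable K E" using stable_if_galois_ext[OF K _ E(2)] by blast
  qed
  let ?S = "M \<union> \<Union>{E. E \<subseteq> quad_closure F \<and> quad_ext M E \<and> galois_ext K E}"
  have S: "?S \<subseteq> Q" using M E(1) by blast
  then show "qstep F K M \<subseteq> Q" unfolding qstep_def by (rule field_gen_least[OF Q])
  show "stable K (qstep F K M)"
    unfolding qstep_def
  proof (rule stable_field_gen[OF K(1) S])
    fix \<sigma> x assume \<sigma>: "\<sigma> \<in> gal K" and "x \<in> ?S"
    then have "\<sigma> x \<in> ?S" using M(2) E(2) stableD[OF _ \<sigma>] by blast
    then show "\<sigma> x \<in> field_gen ?S" by (rule subsetD[OF field_gen_superset])
  qed
qed

lemma kseq_properties: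
  assumes K: "subfield K" "F \<subseteq> K" "K \<subseteq> Q"
  shows "subfield (kseq F K n) \<and> K \<subseteq> kseq F K n \<and> kseq F K n \<subseteq> Q \<and> stable K (kseq F K n)"
proof (induction n)
  case 0
  then show ?case using K by (auto simp: stable_def gal_def)
next
  case (Suc n)
  then show ?case
    using qstep_properties[OF K(2,3), of "kseq F K n"] qstep_superset[of "kseq F K n" K]
    by (auto simp: qstep_def)
qed

text \<open>The index is shifted by one: \<open>Fn n\<close> is \<open>F\<^sup>(\<^sup>n\<^sup>+\<^sup>1\<^sup>)\<close>.\<close>

abbreviation "Fn \<equiv> kseq F F"

lemma Fn: "subfield (Fn n)" "F \<subseteq> Fn n" "Fn n \<subseteq> Q" "stable F (Fn n)"
  using kseq_properties[OF F order_refl F_subset_Q] by auto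

lemma Fn_Suc: "Fn n \<subseteq> Fn (Suc n)"
  using qstep_superset by simp

text \<open>Invariance of the square class of \<open>z * z\<close> is what makes \<open>Fn n(z)\<close> Galois over \<open>F\<close>.\<close>

lemma sqrt_in_Fn_Suc:
  assumes z: "z * z \<in> Fn n"
    and inv: "\<And>\<tau>. \<tau> \<in> gal F \<Longrightarrow> \<exists>m\<in>Fn n. \<tau> (z * z) = z * z * (m * m)"
  shows "z \<in> Fn (Suc n)"
proof (cases "z \<in> Fn n")
  case True
  then show ?thesis using Fn_Suc by blast
next
  case False
  let ?E = "adjoin (Fn n) {z}"
  have zQ: "z \<in> Q" using z Fn(3) Q_sqrt[of z] by blast
  have EQ: "?E \<subseteq> Q" using adjoin_subset_Q Fn(3) z by blast
  have sup: "Fn n \<union> {z} \<subseteq> ?E" unfolding adjoin_def by (rule field_gen_superset)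
  have "stable F ?E"
    unfolding adjoin_def
  proof (rule stable_field_gen[OF order_refl])
    show "Fn n \<union> {z} \<subseteq> Q" using Fn(3) zQ by blast
    fix \<tau> x assume \<tau>: "\<tau> \<in> gal F" and x: "x \<in> Fn n \<union> {z}"
    have "\<tau> z \<in> ?E"
    proof -
      obtain m where m: "m \<in> Fn n" "\<tau> (z * z) = z * z * (m * m)" using inv[OF \<tau>] by blast
      then have "\<tau> z * \<tau> z = (z * m) * (z * m)" using galD(2)[OF \<tau> zQ zQ] by (simp add: algebra_simps)
      then have "\<tau> z = z * m \<or> \<tau> z = - (z * m)" by (simp add: square_eq_iff)
      moreover have "z * m \<in> ?E" using sup m(1) by (intro subfieldD(4)[OF subfield_adjoin]) auto
      ultimately show ?thesis using subfieldD(5)[OF subfield_adjoin] by auto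
    qed
    then show "\<tau> x \<in> field_gen (Fn n \<union> {z})"
      using x stableD[OF Fn(4) \<tau>] sup by (auto simp: adjoin_def)
  qed
  moreover have "F \<subseteq> ?E" using Fn(2) sup by blast
  ultimately have "galois_ext F ?E" using EQ by (intro galois_ext_if_stable) auto
  moreover have "quad_ext (Fn n) ?E" by (rule quad_ext_adjoin_square_root[OF Fn(1) z False])
  moreover have "?E \<subseteq> quad_closure F" using EQ Q_subset_quad_closure by blast
  ultimately have "?E \<subseteq> Fn (Suc n)"
    unfolding kseq.simps qstep_def by (intro order_trans[OF _ field_gen_superset]) blast
  then show ?thesis using sup by blast
qed

text \<open>Kummer theory in degree 2. Write \<open>\<rho> z = u + v * z\<close>; its square lies in
  \<open>M\<close>, which forces \<open>2 * u * v = 0\<close>. If \<open>u = 0\<close>, the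
  multiplier is \<open>v\<close>; if \<open>v = 0\<close>, then \<open>\<rho> z\<close> and hence
  \<open>z\<close> would lie in \<open>M\<close>.\<close>

lemma square_class_invariant:
  assumes K: "F \<subseteq> K" "K \<subseteq> Q" and M: "subfield M" "M \<subseteq> Q" "stable K M"
    and z: "z * z \<in> M" "z \<notin> M" and st: "stable K (adjoin M {z})" and \<rho>: "\<rho> \<in> gal K"
  shows "\<exists>m\<in>M. \<rho> (z * z) = z * z * (m * m)"
proof -
  have \<rho>F: "\<rho> \<in> gal F" using \<rho> gal_antimono K(1) by blast
  have zQ: "z \<in> Q" using z(1) M(2) Q_sqrt[of z] by blast
  have "\<rho> z \<in> adjoin M {z}" using stableD[OF st \<rho>] by simp
  then obtain u v where uv: "u \<in> M" "v \<in> M" "\<rho> z = u + v * z"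
    using adjoin_square_root[OF M(1) z(1)] by blast
  note f = subfieldD[OF M(1)]
  have sq: "\<rho> (z * z) = \<rho> z * \<rho> z" by (rule galD(2)[OF \<rho>F zQ zQ])
  have "\<rho> (z * z) = (u * u + v * v * (z * z)) + (2 * u * v) * z"
    unfolding sq uv(3) by (simp add: algebra_simps)
  then have e: "(2 * u * v) * z = \<rho> (z * z) - (u * u + v * v * (z * z))" by simp
  have "\<rho> (z * z) \<in> M" using stableD[OF M(3) \<rho> z(1)] .
  then have "(2 * u * v) * z \<in> M" unfolding e using f(3,4,7) uv z(1) by auto
  moreover have c: "2 * u * v \<in> M" using f(3)[OF f(2) f(2)] f(4) uv by auto
  ultimately have "(2 * u * v) * z / (2 * u * v) \<in> M" by (rule f(8))
  then have "2 * u * v = 0" using z(2) nonzero_mult_div_cancel_left[of "2 * u * v" z] by metis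
  then consider "u = 0" | "v = 0" using two by auto
  then show ?thesis
  proof cases
    case 1
    then have "\<rho> (z * z) = z * z * (v * v)" using sq uv(3) by (simp add: algebra_simps)
    then show ?thesis using uv(2) by blast
  next
    case 2
    \<comment> \<open>The inverse automorphism carries \<open>u = \<rho> z\<close> back to
      \<open>z\<close>, and \<open>M\<close> is stable under it.\<close>
    obtain \<tau> where "\<tau> \<in> gal K" "\<tau> (\<rho> z) = z" using gal_inv[OF K \<rho>] zQ by metis
    then have "z \<in> M" using stableD[OF M(3), of \<tau> u] uv 2 by simp
    then show ?thesis using z(2) by blast
  qed
qed

text \<open>Bounding a step of the filtration reduces to square roots whose square class is
  invariant over \<open>K\<close>.\<close>

lemma qstep_subset:
  assumes K: "F \<subseteq> K" "K \<subseteq> Q" and M: "subfield M" "M \<subseteq> Q" "stable K M"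
    and T: "subfield T" "M \<subseteq> T"
    and roots: "\<And>z. z * z \<in> M \<Longrightarrow> z \<notin> M \<Longrightarrow>
      (\<And>\<rho>. \<rho> \<in> gal K \<Longrightarrow> \<exists>m\<in>M. \<rho> (z * z) = z * z * (m * m)) \<Longrightarrow> z \<in> T"
  shows "qstep F K M \<subseteq> T"
proof -
  have "E \<subseteq> T" if E: "quad_ext M E" "galois_ext K E" for E
  proof -
    obtain z where z: "z * z \<in> M" "z \<notin> M" "E = adjoin M {z}"
      using quad_ext_imp_square_root[OF E(1) two] by blast
    then have "E \<subseteq> Q" using adjoin_subset_Q M(2) by blast
    then have "stable K (adjoin M {z})" using stable_if_galois_ext[OF K _ E(2)] z(3) by blast
    then have "z \<in> T" using roots[OF z(1,2)] square_class_invariant[OF K M z(1,2)] by blast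
    then show ?thesis unfolding z(3) using T by (intro adjoin_least) auto
  qed
  then show ?thesis unfolding qstep_def using T by (intro field_gen_least) auto
qed

end

section \<open>Comparing the filtrations over \<open>L\<close> and over \<open>F\<close>\<close>

locale quadratic_extension = quadratic_base +
  fixes b :: 'a
  assumes b: "b * b \<in> F" "b \<notin> F"
begin

abbreviation "L \<equiv> adjoin F {b}"

lemma b_Q: "b \<in> Q"
  using b(1) F_subset_Q Q_sqrt[of b] by blast

lemma L: "subfield L" "F \<subseteq> L" "L \<subseteq> Q"
  using adjoin_superset adjoin_subset_Q[OF F_subset_Q subsetD[OF F_subset_Q b(1)]] by simp_all

lemma gal_b:
  assumes "\<tau> \<in> gal F"
  shows "\<tau> b = b \<or> \<tau> b = - b"
proof -
  have "\<tau> b * \<tau> b = b * b" using galD(2)[OF assms b_Q b_Q] galD(3)[OF assms b(1)] by simp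
  then show ?thesis by (simp add: square_eq_iff)
qed

lemma gal_L:
  assumes "\<tau> \<in> gal F" "\<tau> b = b"
  shows "\<tau> \<in> gal L"
proof -
  have "L \<subseteq> {x \<in> Q. \<tau> x = x}"
  proof (rule adjoin_least)
    show "subfield {x \<in> Q. \<tau> x = x}"
      using subfieldD[OF Q] subfieldD(2)[OF F] galD[OF assms(1)] gal_minus[OF assms(1)]
        gal_inverse[OF assms(1)] by (intro subfieldI) auto
    show "F \<subseteq> {x \<in> Q. \<tau> x = x}" using F_subset_Q galD(3)[OF assms(1)] by auto
    show "{b} \<subseteq> {x \<in> Q. \<tau> x = x}" using b_Q assms(2) by simp
  qed
  then show ?thesis using assms(1) by (auto simp: gal_def)
qed

lemma conjugation_exists:
  obtains \<sigma> where "\<sigma> \<in> gal F" "\<sigma> b = - b"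
proof -
  have "\<not> (\<forall>\<sigma>\<in>gal F. \<sigma> b = b)" using gal_fixed_field[OF b_Q] b(2) by blast
  then show ?thesis using gal_b that by blast
qed

text \<open>An automorphism with invariant action over \<open>L\<close> matters only through its
  coset modulo \<open>gal L\<close>, and that coset is determined by the image of \<open>b\<close>.
  Concretely, \<open>\<beta>\<close> inverse after \<open>\<alpha>\<close> fixes \<open>L\<close>;
  applying \<open>\<beta>\<close> transports the multiplier.\<close>

lemma square_class_coset:
  assumes M: "subfield M" "M \<subseteq> Q" "stable F M" and y: "y \<in> Q"
    and inv: "\<And>\<rho>. \<rho> \<in> gal L \<Longrightarrow> \<exists>m\<in>M. \<rho> y = y * (m * m)"
    and ab: "\<alpha> \<in> gal F" "\<beta> \<in> gal F" "\<alpha> b = \<beta> b"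
  shows "\<exists>m\<in>M. \<alpha> y = \<beta> y * (m * m)"
proof -
  obtain \<gamma> where \<gamma>: "\<gamma> \<in> gal F" "\<And>x. x \<in> Q \<Longrightarrow> \<beta> (\<gamma> x) = x" "\<And>x. x \<in> Q \<Longrightarrow> \<gamma> (\<beta> x) = x"
    using gal_inv[OF order_refl F_subset_Q ab(2)] by blast
  have "\<gamma> \<circ> \<alpha> \<in> gal L"
    using gal_comp[OF _ \<gamma>(1) ab(1)] ab(3) \<gamma>(3)[OF b_Q] by (intro gal_L) auto
  then obtain m where m: "m \<in> M" "\<gamma> (\<alpha> y) = y * (m * m)" using inv[of "\<gamma> \<circ> \<alpha>"] by auto
  have mQ: "m \<in> Q" "m * m \<in> Q" using m(1) M(2) subfieldD(4)[OF Q] by auto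
  have "\<alpha> y = \<beta> (y * (m * m))" using \<gamma>(2)[OF gal_mem_Q[OF ab(1) y]] m(2) by simp
  also have "\<dots> = \<beta> y * (\<beta> m * \<beta> m)"
    using galD(2)[OF ab(2) y mQ(2)] galD(2)[OF ab(2) mQ(1) mQ(1)] by simp
  finally show ?thesis using stableD[OF M(3) ab(2) m(1)] by blast
qed

text \<open>Two steps suffice: the norm \<open>y \<cdot> \<sigma> y\<close> has an invariant square class, and
  adjoining its square root makes the class of \<open>y\<close> invariant.\<close>

lemma sqrt_in_Fn_Suc_Suc:
  assumes \<sigma>: "\<sigma> \<in> gal F" "\<sigma> b = - b" and y: "z * z \<noteq> 0" "z * z \<in> Fn (Suc n)"
    and norm: "z * z * \<sigma> (z * z) \<in> Fn n"
    and inv: "\<And>\<rho>. \<rho> \<in> gal L \<Longrightarrow> \<exists>m\<in>Fn n. \<rho> (z * z) = z * z * (m * m)"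
  shows "z \<in> Fn (Suc (Suc n))"
proof -
  define y where "y = z * z"
  have yQ: "y \<in> Q" unfolding y_def using Fn(3) y(2) by (rule subsetD)
  have sQ: "\<sigma> y \<in> Q" by (rule gal_mem_Q[OF \<sigma>(1) yQ])
  have coset: "\<exists>m\<in>Fn n. \<alpha> y = \<beta> y * (m * m)" if "\<alpha> \<in> gal F" "\<beta> \<in> gal F" "\<alpha> b = \<beta> b" for \<alpha> \<beta>
  proof (rule square_class_coset[OF Fn(1) Fn(3) Fn(4) yQ _ that])
    show "\<exists>m\<in>Fn n. \<rho> y = y * (m * m)" if "\<rho> \<in> gal L" for \<rho>
      unfolding y_def by (rule inv[OF that])
  qed
  have id: "id \<in> gal F" by (auto simp: gal_def)
  obtain w where w: "w * w = y * \<sigma> y" using sqrt_exists by blast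
  have wF: "w \<in> Fn (Suc n)"
  proof (rule sqrt_in_Fn_Suc)
    show "w * w \<in> Fn n" using norm by (simp add: w y_def)
  next
    fix \<tau> assume \<tau>: "\<tau> \<in> gal F"
    have \<tau>\<sigma>: "\<tau> \<circ> \<sigma> \<in> gal F" by (rule gal_comp[OF order_refl \<tau> \<sigma>(1)])
    have nb: "\<tau> (- b) = - \<tau> b" by (rule gal_minus[OF \<tau> b_Q])
    \<comment> \<open>According to its effect on \<open>b\<close>, \<open>\<tau>\<close> preserves
      or exchanges the classes of \<open>y\<close> and \<open>\<sigma> y\<close>; either way the
      class of the product is unchanged.\<close>
    have "\<exists>m\<in>Fn n. \<exists>m'\<in>Fn n. \<tau> y * \<tau> (\<sigma> y) = y * \<sigma> y * (m * m) * (m' * m')"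
    proof (cases "\<tau> b = b")
      case True
      obtain m where m: "m \<in> Fn n" "\<tau> y = y * (m * m)"
        using coset[OF \<tau> id] True by auto
      obtain m' where m': "m' \<in> Fn n" "\<tau> (\<sigma> y) = \<sigma> y * (m' * m')"
        using coset[OF \<tau>\<sigma> \<sigma>(1)] True \<sigma>(2) nb by auto
      show ?thesis using m m' by (intro bexI[of _ m] bexI[of _ m']) (simp_all add: algebra_simps)
    next
      case False
      then have \<tau>b: "\<tau> b = - b" using gal_b[OF \<tau>] by blast
      obtain m where m: "m \<in> Fn n" "\<tau> y = \<sigma> y * (m * m)"
        using coset[OF \<tau> \<sigma>(1)] \<tau>b \<sigma>(2) by auto
      obtain m' where m': "m' \<in> Fn n" "\<tau> (\<sigma> y) = y * (m' * m')"
        using coset[OF \<tau>\<sigma> id] \<tau>b \<sigma>(2) nb by auto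
      show ?thesis using m m' by (intro bexI[of _ m] bexI[of _ m']) (simp_all add: algebra_simps)
    qed
    then obtain m m' where m: "m \<in> Fn n" "m' \<in> Fn n"
      "\<tau> y * \<tau> (\<sigma> y) = y * \<sigma> y * (m * m) * (m' * m')" by blast
    have "\<tau> (w * w) = w * w * ((m * m') * (m * m'))"
      unfolding w using galD(2)[OF \<tau> yQ sQ] m(3) by (simp add: algebra_simps)
    moreover have "m * m' \<in> Fn n" using subfieldD(4)[OF Fn(1)] m by blast
    ultimately show "\<exists>m\<in>Fn n. \<tau> (w * w) = w * w * (m * m)" by blast
  qed
  show ?thesis
  proof (rule sqrt_in_Fn_Suc[OF y(2)])
    fix \<tau> assume \<tau>: "\<tau> \<in> gal F"
    show "\<exists>m\<in>Fn (Suc n). \<tau> (z * z) = z * z * (m * m)"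
    proof (cases "\<tau> b = b")
      case True
      then show ?thesis using coset[OF \<tau> id] Fn_Suc[of n] unfolding y_def by auto
    next
      case False
      then have "\<tau> b = \<sigma> b" using gal_b[OF \<tau>] \<sigma>(2) by auto
      then obtain m where m: "m \<in> Fn n" "\<tau> y = \<sigma> y * (m * m)" using coset[OF \<tau> \<sigma>(1)] by blast
      have y0: "y \<noteq> 0" using y(1) by (simp add: y_def)
      \<comment> \<open>From \<open>w * w = y * \<sigma> y\<close> one gets
        \<open>\<sigma> y = y * (w / y) * (w / y)\<close>, so the classes of \<open>y\<close> and
        \<open>\<sigma> y\<close> agree once \<open>w\<close> is available.\<close>
      have "y * ((w / y * m) * (w / y * m)) = (w * w) / y * (m * m)" using y0 by simp
      also have "\<dots> = \<tau> y" unfolding w m(2) using y0 by simp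
      finally have "\<tau> y = y * ((w / y * m) * (w / y * m))" by simp
      moreover have "w / y * m \<in> Fn (Suc n)"
        unfolding y_def by (intro subfieldD(4,8)[OF Fn(1)] wF y(2) subsetD[OF Fn_Suc m(1)])
      ultimately show ?thesis unfolding y_def by blast
    qed
  qed
qed

lemma kseq_L: "subfield (kseq F L n)" "L \<subseteq> kseq F L n" "kseq F L n \<subseteq> Q" "stable L (kseq F L n)"
  using kseq_properties[OF L] by auto

lemma L_subset: "L \<subseteq> Fn 1"
proof (rule adjoin_least[OF Fn(1,2)])
  have "b \<in> Fn (Suc 0)"
  proof (rule sqrt_in_Fn_Suc)
    show "b * b \<in> Fn 0" using b by simp
    show "\<exists>m\<in>Fn 0. \<tau> (b * b) = b * b * (m * m)" if "\<tau> \<in> gal F" for \<tau>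
      using galD(3)[OF that b(1)] subfieldD(2)[OF F] by (intro bexI[of _ 1]) auto
  qed
  then show "{b} \<subseteq> Fn 1" by simp
qed

text \<open>An element \<open>u + v * b\<close> of \<open>L\<close> is only known to lie in
  \<open>Fn 1\<close>, but its norm lies in \<open>F = Fn 0\<close>. The two-step lemma therefore
  starts at index 0, which saves one level.\<close>

lemma L2_subset: "kseq F L 1 \<subseteq> Fn 2"
proof -
  obtain \<sigma> where \<sigma>: "\<sigma> \<in> gal F" "\<sigma> b = - b" by (rule conjugation_exists)
  have "qstep F L L \<subseteq> Fn 2"
  proof (rule qstep_subset[OF L(2,3)])
    show "subfield L" "L \<subseteq> Q" "stable L L" using kseq_L[of 0] by auto
    show "subfield (Fn 2)" by (rule Fn(1))
    show "L \<subseteq> Fn 2" using L_subset Fn_Suc[of 1] by (simp add: numeral_2_eq_2)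
  next
    fix z assume z: "z * z \<in> L" "z \<notin> L"
    then obtain u v where uv: "u \<in> F" "v \<in> F" "z * z = u + v * b"
      using adjoin_square_root[OF F b(1)] by blast
    have uvQ: "u \<in> Q" "v \<in> Q" "v * b \<in> Q" using uv F_subset_Q subfieldD(4)[OF Q] b_Q by auto
    have "\<sigma> (z * z) = u - v * b"
      unfolding uv(3) using galD(1)[OF \<sigma>(1) uvQ(1,3)] galD(2)[OF \<sigma>(1) uvQ(2) b_Q]
        galD(3)[OF \<sigma>(1) uv(1)] galD(3)[OF \<sigma>(1) uv(2)] \<sigma>(2) by simp
    then have "z * z * \<sigma> (z * z) = (u + v * b) * (u - v * b)" using uv(3) by simp
    also have "\<dots> = u * u - v * v * (b * b)" by (simp add: algebra_simps)
    finally have "z * z * \<sigma> (z * z) = u * u - v * v * (b * b)" .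
    moreover have "u * u - v * v * (b * b) \<in> F" using uv b subfieldD(4,7)[OF F] by auto
    ultimately have norm: "z * z * \<sigma> (z * z) \<in> Fn 0" by simp
    have "z \<in> Fn (Suc (Suc 0))"
    proof (rule sqrt_in_Fn_Suc_Suc[OF \<sigma> _ _ norm])
      show "z * z \<noteq> 0" using z(2) subfieldD(1)[OF L(1)] by auto
      show "z * z \<in> Fn (Suc 0)" using z(1) L_subset by auto
      \<comment> \<open>Elements of \<open>gal L\<close> fix \<open>z * z \<in> L\<close>, so the
        multiplier is 1.\<close>
      show "\<exists>m\<in>Fn 0. \<rho> (z * z) = z * z * (m * m)" if "\<rho> \<in> gal L" for \<rho>
        using that z(1) subfieldD(2)[OF F] by (intro bexI[of _ 1]) (auto simp: gal_def)
    qed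
    then show "z \<in> Fn 2" by (simp add: numeral_2_eq_2)
  qed
  then show ?thesis by simp
qed

text \<open>Now \<open>z * z\<close> and, by stability, its norm lie in \<open>Fn 2\<close>, and so
  do the multipliers; two further steps lead to \<open>Fn 4\<close>.\<close>

lemma L3_subset: "kseq F L 2 \<subseteq> Fn 4"
proof -
  obtain \<sigma> where \<sigma>: "\<sigma> \<in> gal F" "\<sigma> b = - b" by (rule conjugation_exists)
  have four: "4 = Suc (Suc 2)" by simp
  have F24: "Fn 2 \<subseteq> Fn 4" unfolding four using Fn_Suc Fn_Suc by (rule order_trans)
  have "qstep F L (kseq F L 1) \<subseteq> Fn 4"
  proof (rule qstep_subset[OF L(2,3) kseq_L(1,3,4) Fn(1)])
    show "kseq F L 1 \<subseteq> Fn 4" using L2_subset F24 by blast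
  next
    fix z assume z: "z * z \<in> kseq F L 1" "z \<notin> kseq F L 1"
      and inv: "\<And>\<rho>. \<rho> \<in> gal L \<Longrightarrow> \<exists>m\<in>kseq F L 1. \<rho> (z * z) = z * z * (m * m)"
    have y: "z * z \<in> Fn 2" using z(1) L2_subset by blast
    have "z \<in> Fn (Suc (Suc 2))"
    proof (rule sqrt_in_Fn_Suc_Suc[OF \<sigma>])
      show "z * z \<noteq> 0" using z(2) subfieldD(1)[OF kseq_L(1), of 1] by auto
      show "z * z \<in> Fn (Suc 2)" using y Fn_Suc by blast
      show "z * z * \<sigma> (z * z) \<in> Fn 2"
        using subfieldD(4)[OF Fn(1) y stableD[OF Fn(4) \<sigma>(1) y]] .
      show "\<exists>m\<in>Fn 2. \<rho> (z * z) = z * z * (m * m)" if "\<rho> \<in> gal L" for \<rho>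
        using inv[OF that] L2_subset by blast
    qed
    then show "z \<in> Fn 4" by (simp only: four)
  qed
  then show ?thesis by (simp add: numeral_2_eq_2)
qed

end

theorem theorem2:
  fixes F :: "'a::alg_closed_field set" and a b :: 'a
  assumes "subfield F"
    and "(2::'a) \<noteq> 0"
    and "a \<in> F" and "a \<noteq> 0"
    and "\<not> (\<exists>c\<in>F. c * c = a)"
    and "b * b = a"
  shows "galois_closure F (Kpow F (adjoin F {b}) 3) \<subseteq> Kpow F F 5"
proof -
  interpret quadratic_extension F b
  proof unfold_locales
    show "subfield F" "(2::'a) \<noteq> 0" by fact+
    show "b * b \<in> F" using assms(3,6) by simp
    show "b \<notin> F" using assms(5,6) by blast
  qed
  \<comment> \<open>\<open>Fn 4\<close> is the fifth field of the filtration; being Galois over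
    \<open>F\<close> and inside \<open>quad_closure F\<close>, it is one of the fields intersected
    in \<open>galois_closure\<close>.\<close>
  have "galois_ext F (Fn 4)" by (rule galois_ext_if_stable[OF Fn])
  moreover have "Fn 4 \<subseteq> quad_closure F" using Fn(3) Q_subset_quad_closure by blast
  ultimately have "galois_closure F (kseq F L 2) \<subseteq> Fn 4"
    unfolding galois_closure_def using L3_subset by (intro Inter_lower) simp
  then show ?thesis by (simp add: Kpow_def)
qed

end
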